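(* For all $n\ge1$, \[P_{\mathcal{B}_n}(z)=\sum_{w\in BW^B_n}z^{\operatorname{des}(w)},\] where $BW^B_n$ is the set of signed permutations $w\in\mathfrak{B}_n$ such that every right-to-left maximum of $|w|=|w_1||w_2|\cdots|w_n|$ is negative in $w$ (i.e. $w_i<0$ whenever $|w_i|>|w_j|$ for all $j>i$), and $\operatorname{des}(w)=\#\{i\in\{0,\dots,n-1\}:w(i)>w(i+1)\}$ with $w(0):=0$.
   Context: $\mathfrak{B}_n$ is the group of permutations $w$ of $[\pm n]=\{-n,\dots,-1,1,\dots,n\}$ with $w(-i)=-w(i)$, written in window notation $w_1\cdots w_n$, $w_i=w(i)$. $\mathcal{B}_n$ is the arrangement in $\mathbb{R}^n$ of hyperplanes $x_i=\pm x_j$ ($i<j$) and $x_i=0$. $P_{\mathcal{A}}(z)=\sum_{\mathrm{X}}|\mu(\bot,\mathrm{X})|(z-1)^{\operatorname{codim}\mathrm{X}}$, summed over flats (intersections of subsets of hyperplanes), $\mu$ the Möbius function of the lattice of flats under inclusion, $\bot$ its minimum. *)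

theory Defs
  imports "HOL-Analysis.Analysis"
begin

function mobius :: "'a set set \<Rightarrow> 'a set \<Rightarrow> 'a set \<Rightarrow> int" where
  "mobius P x y =
     (if finite P \<and> x \<in> P \<and> y \<in> P \<and> x \<subseteq> y then
        (if x = y then 1
         else - (\<Sum>u\<in>{u\<in>P. x \<subseteq> u \<and> u \<subset> y}. mobius P x u))
      else 0)"
  by pat_completeness auto
termination
proof (relation "Wellfounded.measure (\<lambda>(P,x,y). card {u\<in>P. x \<subseteq> u \<and> u \<subset> y})")
  fix P :: "'a set set" and x y u
  assume a: "finite P \<and> x \<in> P \<and> y \<in> P \<and> x \<subseteq> y" "x \<noteq> y"
     and u: "u \<in> {u\<in>P. x \<subseteq> u \<and> u \<subset> y}"
  have "{w\<in>P. x \<subseteq> w \<and> w \<subset> u} \<subset> {w\<in>P. x \<subseteq> w \<and> w \<subset> y}"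
    using u by auto
  show "((P, x, u), P, x, y) \<in> Wellfounded.measure (\<lambda>(P,x,y). card {u\<in>P. x \<subseteq> u \<and> u \<subset> y})"
  proof -
    from \<open>_ \<subset> _\<close> have "card {w\<in>P. x \<subseteq> w \<and> w \<subset> u} < card {w\<in>P. x \<subseteq> w \<and> w \<subset> y}"
      by (rule psubset_card_mono[rotated]) (use a in auto)
    then show ?thesis by simp
  qed
qed auto

definition B_hyperplanes :: "(real ^ 'n) set set" where
  "B_hyperplanes =
     {{x. x $ i = x $ j} | i j. i \<noteq> j} \<union>
     {{x. x $ i = - (x $ j)} | i j. i \<noteq> j} \<union>
     {{x. x $ i = 0} | i. True}"

definition B_flats :: "(real ^ 'n) set set" where
  "B_flats = {\<Inter> S | S. S \<subseteq> B_hyperplanes}"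

definition B_bot :: "(real ^ 'n) set" where
  "B_bot = \<Inter> B_hyperplanes"

definition poincare_B :: "'n::finite itself \<Rightarrow> 'a::comm_ring_1 \<Rightarrow> 'a" where
  "poincare_B _ z = (\<Sum>X\<in>(B_flats :: (real ^ 'n) set set).
      of_int \<bar>mobius B_flats B_bot X\<bar> * (z - 1) ^ (CARD('n) - dim X))"

text \<open>Signed permutations of [+-n] as functions on int, extended by the identity
  outside [+-n] (so in particular w 0 = 0).\<close>
definition signed_perms :: "nat \<Rightarrow> (int \<Rightarrow> int) set" where
  "signed_perms n = {w. bij_betw w {i. 1 \<le> \<bar>i\<bar> \<and> \<bar>i\<bar> \<le> int n} {i. 1 \<le> \<bar>i\<bar> \<and> \<bar>i\<bar> \<le> int n}
      \<and> (\<forall>i. 1 \<le> \<bar>i\<bar> \<and> \<bar>i\<bar> \<le> int n \<longrightarrow> w (-i) = - w i)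
      \<and> (\<forall>i. \<not> (1 \<le> \<bar>i\<bar> \<and> \<bar>i\<bar> \<le> int n) \<longrightarrow> w i = i)}"

definition BW_B :: "nat \<Rightarrow> (int \<Rightarrow> int) set" where
  "BW_B n = {w \<in> signed_perms n.
      \<forall>i\<in>{1..int n}. (\<forall>j\<in>{i+1..int n}. \<bar>w i\<bar> > \<bar>w j\<bar>) \<longrightarrow> w i < 0}"

definition desB :: "nat \<Rightarrow> (int \<Rightarrow> int) \<Rightarrow> nat" where
  "desB n w = card {i\<in>{0..int n - 1}. (if i = 0 then 0 else w i) > w (i + 1)}"

end

theory Submission
  imports Defs
begin

text \<open>
  A flat of dimension k is encoded by the integer point on it whose i-th entry is 0 or, up to sign,
  the least index whose coordinate agrees with the i-th one on the flat up to sign; the dimension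
  is the number of indices that are their own label. Adding a new largest index to a code with k
  such indices leaves 2k + 1 labels that do not raise the dimension and one that does. Hence
  (-1)^k (2k-1)!! solves the recursion of the Moebius function, and the coefficient f(n,j)
  of (z-1)^j in the Poincare polynomial satisfies
  f(n+1,j+1) = (2n-2j+1) f(n,j) + (2n-2j-1) f(n,j+1).

  On the other side, every element of the set for n + 1 arises uniquely by raising all absolute values
  in an element of the set for n and inserting 1 or -1, where only -1 may be put at the end. If the
  given element has d descents, 2d of these insertions keep the number of descents and
  2n + 1 - 2d increase it by one, so the sums of the binomials (des choose j) satisfy
  the same recursion.
\<close>

section \<open>Codes\<close>

text \<open>Each entry \<open>c i\<close> is 0 or \<open>\<plusminus>r\<close> with \<open>0 < r \<le> i\<close> and \<open>c r = r\<close>.\<close>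
definition is_code :: "(nat \<Rightarrow> int) \<Rightarrow> bool" where
  "is_code c \<longleftrightarrow> (\<forall>i. nat \<bar>c i\<bar> \<le> i \<and> c i = sgn (c i) * c (nat \<bar>c i\<bar>))"

definition codes :: "nat \<Rightarrow> (nat \<Rightarrow> int) set" where
  "codes n = {c. is_code c \<and> (\<forall>i>n. c i = 0)}"

text \<open>The codes of the flats contained in the flat with code \<open>c\<close>, with only the first \<open>n\<close> coordinates
  taken into account.\<close>
definition codes_below :: "(nat \<Rightarrow> int) \<Rightarrow> nat \<Rightarrow> (nat \<Rightarrow> int) set" where
  "codes_below c n = {c' \<in> codes n. \<forall>i\<le>n. c' i = sgn (c i) * c' (nat \<bar>c i\<bar>)}"

text \<open>Every code has \<open>c 0 = 0\<close>, so index 0 is left out; the other fixed indices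
  are the coordinates that can be chosen freely on the flat.\<close>

definition code_fixpoints :: "(nat \<Rightarrow> int) \<Rightarrow> nat set" where
  "code_fixpoints c = {i. 0 < i \<and> c i = int i}"

definition nfix :: "(nat \<Rightarrow> int) \<Rightarrow> nat" where
  "nfix c = card (code_fixpoints c)"

text \<open>The admissible values at index \<open>Suc m\<close> when a code \<open>c'\<close> below
  \<open>c\<close> on the first \<open>m\<close> indices is extended. If \<open>c\<close> leaves the
  new coordinate free, it may open a class of its own, vanish, or join an old class with either
  sign; otherwise the relation recorded by \<open>c\<close> forces it.\<close>

definition code_choices :: "(nat \<Rightarrow> int) \<Rightarrow> nat \<Rightarrow> (nat \<Rightarrow> int) \<Rightarrow> int set" where
  "code_choices c m c' =
     (if c (Suc m) = int (Suc m)
      then insert (int (Suc m)) (insert 0 (int ` code_fixpoints c' \<union> (\<lambda>r. - int r) ` code_fixpoints c'))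
      else {sgn (c (Suc m)) * c' (nat \<bar>c (Suc m)\<bar>)})"

lemma is_codeD:
  assumes "is_code c"
  shows "nat \<bar>c i\<bar> \<le> i" "c i = sgn (c i) * c (nat \<bar>c i\<bar>)"
  using assms unfolding is_code_def by blast+

lemma codes_belowD:
  assumes "c' \<in> codes_below c n"
  shows "c' \<in> codes n" "i \<le> n \<Longrightarrow> c' i = sgn (c i) * c' (nat \<bar>c i\<bar>)"
  using assms unfolding codes_below_def by blast+

lemma is_code_0: "is_code c \<Longrightarrow> c 0 = 0"
  using is_codeD(1)[of c 0] by simp

text \<open>In the last case \<open>r < i\<close> is strict, because an index that is its own label
  carries the sign +1.\<close>

lemma is_code_cases:
  assumes "is_code c"
  obtains "c i = 0"
    | r where "0 < r" "r \<le> i" "c r = int r" "c i = int r"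
    | r where "0 < r" "r < i" "c r = int r" "c i = - int r"
proof -
  define r where "r = nat \<bar>c i\<bar>"
  have r: "r \<le> i" "c i = sgn (c i) * c r" "int r = \<bar>c i\<bar>"
    using is_codeD[OF assms, of i] by (simp_all only: r_def)
  consider "c i = 0" | "c i > 0" | "c i < 0" by linarith
  then show thesis
  proof cases
    case 2
    then have "c r = int r" "c i = int r" "0 < r" using r(2,3) by simp_all
    then show thesis using r(1) that(2)[of r] by blast
  next
    case 3
    then have rr: "c r = int r" "c i = - int r" "0 < r" using r(2,3) by simp_all
    then have "r \<noteq> i" by auto
    then show thesis using r(1) rr that(3)[of r] by linarith
  qed (use that in blast)
qed

lemma is_code_abs_eq: "is_code c \<Longrightarrow> nat \<bar>c i\<bar> = i \<Longrightarrow> c i = int i"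
  by (cases rule: is_code_cases[of c i]) auto

lemma is_codeI:
  assumes "\<And>i. c i = 0 \<or> (\<exists>r\<in>code_fixpoints c. r \<le> i \<and> (c i = int r \<or> c i = - int r))"
  shows "is_code c"
  unfolding is_code_def
proof
  fix i
  show "nat \<bar>c i\<bar> \<le> i \<and> c i = sgn (c i) * c (nat \<bar>c i\<bar>)"
    using assms[of i] by (auto simp: code_fixpoints_def)
qed

text \<open>Here each index is its own label, which describes the whole space. Through
  \<open>codes_below_int\<close> all codes become a special case of the codes below a given
  one.\<close>

lemma is_code_int: "is_code int"
  by (auto simp: is_code_def sgn_if)

lemma codes_below_int: "codes_below int n = codes n"
proof -
  have "c i = sgn (int i) * c (nat \<bar>int i\<bar>)" if "c \<in> codes n" for c i
    using that is_code_0[of c] by (cases "i = 0") (simp_all add: codes_def)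
  then show ?thesis unfolding codes_below_def by blast
qed

lemma code_fixpoints_subset: "c \<in> codes n \<Longrightarrow> code_fixpoints c \<subseteq> {1..n}"
  by (force simp: codes_def code_fixpoints_def intro: leI)

lemma finite_code_fixpoints: "c \<in> codes n \<Longrightarrow> finite (code_fixpoints c)"
  using code_fixpoints_subset finite_subset by blast

lemma nfix_le: "c \<in> codes n \<Longrightarrow> nfix c \<le> n"
  using card_mono[OF _ code_fixpoints_subset[of c n]] by (simp add: nfix_def)

lemma codes_0: "codes 0 = {\<lambda>_. 0}"
proof -
  have "c = (\<lambda>_. 0)" if "c \<in> codes 0" for c
  proof
    show "c i = 0" for i using that is_code_0[of c] by (cases "i = 0") (auto simp: codes_def)
  qed
  then show ?thesis by (auto simp: codes_def is_code_def)
qed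

lemma codes_below_0: "is_code c \<Longrightarrow> codes_below c 0 = {\<lambda>_. 0}"
  by (auto simp: codes_below_def codes_0)

section \<open>Extending and restricting codes at the last index\<close>

lemma code_fixpoints_upd:
  assumes "c \<in> codes m"
  shows "code_fixpoints (c(Suc m := v)) = code_fixpoints c \<union> (if v = int (Suc m) then {Suc m} else {})"
  using code_fixpoints_subset[OF assms] by (auto simp: code_fixpoints_def)

lemma nfix_upd:
  assumes "c \<in> codes m"
  shows "nfix (c(Suc m := v)) = nfix c + (if v = int (Suc m) then 1 else 0)"
proof -
  have "Suc m \<notin> code_fixpoints c" using code_fixpoints_subset[OF assms] by auto
  then show ?thesis
    using finite_code_fixpoints[OF assms] unfolding nfix_def code_fixpoints_upd[OF assms] by simp
qed

lemma codes_upd: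
  assumes c: "c \<in> codes m"
    and v: "v = int (Suc m) \<or> v = 0 \<or> (\<exists>r\<in>code_fixpoints c. v = int r \<or> v = - int r)"
  shows "c(Suc m := v) \<in> codes (Suc m)"
proof -
  have red: "is_code c" using c by (simp add: codes_def)
  have "is_code (c(Suc m := v))"
  proof (rule is_codeI)
    fix i
    have sub: "code_fixpoints c \<subseteq> code_fixpoints (c(Suc m := v))"
      using code_fixpoints_upd[OF c] by auto
    show "(c(Suc m := v)) i = 0 \<or> (\<exists>r\<in>code_fixpoints (c(Suc m := v)). r \<le> i \<and>
        ((c(Suc m := v)) i = int r \<or> (c(Suc m := v)) i = - int r))"
    proof (cases "i = Suc m")
      case True
      consider "v = int (Suc m)" | "v = 0" | r where "r \<in> code_fixpoints c" "v = int r \<or> v = - int r"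
        using v by blast
      then show ?thesis
      proof cases
        case 1
        then show ?thesis using True by (auto simp: code_fixpoints_upd[OF c])
      next
        case 3
        then have "r \<le> Suc m" using code_fixpoints_subset[OF c] by force
        with 3 sub True show ?thesis by auto
      qed (use True in auto)
    next
      case False
      then have eq: "(c(Suc m := v)) i = c i" by simp
      show ?thesis unfolding eq
        by (rule is_code_cases[OF red, of i]) (use sub in \<open>force simp: code_fixpoints_def\<close>)+
    qed
  qed
  then show ?thesis using c by (auto simp: codes_def)
qed

text \<open>Converse to \<open>codes_upd\<close>: labels never exceed their index, so clearing the
  last entry leaves all other labels valid.\<close>

lemma codes_restrict:
  assumes c: "c \<in> codes (Suc m)"
  shows "c(Suc m := 0) \<in> codes m"
    and "c (Suc m) = int (Suc m) \<or> c (Suc m) = 0 \<or>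
      (\<exists>r\<in>code_fixpoints (c(Suc m := 0)). c (Suc m) = int r \<or> c (Suc m) = - int r)"
proof -
  have red: "is_code c" and z: "\<And>i. i > Suc m \<Longrightarrow> c i = 0" using c by (auto simp: codes_def)
  have "is_code (c(Suc m := 0))"
  proof (rule is_codeI)
    fix i
    show "(c(Suc m := 0)) i = 0 \<or> (\<exists>r\<in>code_fixpoints (c(Suc m := 0)). r \<le> i \<and>
        ((c(Suc m := 0)) i = int r \<or> (c(Suc m := 0)) i = - int r))"
    proof (cases "i \<le> m")
      case True
      show ?thesis
        by (rule is_code_cases[OF red, of i]) (use True in \<open>force simp: code_fixpoints_def\<close>)+
    next
      case False
      then show ?thesis using z by (cases "i = Suc m") auto
    qed
  qed
  then show "c(Suc m := 0) \<in> codes m" using z by (auto simp: codes_def)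
  show "c (Suc m) = int (Suc m) \<or> c (Suc m) = 0 \<or>
      (\<exists>r\<in>code_fixpoints (c(Suc m := 0)). c (Suc m) = int r \<or> c (Suc m) = - int r)"
    by (rule is_code_cases[OF red, of "Suc m"]) (force simp: code_fixpoints_def)+
qed

text \<open>Used when the new entry is forced: a signed old entry is a value that
  \<open>codes_upd\<close> accepts.\<close>

lemma is_code_value_choices:
  assumes "is_code c" "s \<in> {-1, 0, 1}"
  shows "s * c i = 0 \<or> (\<exists>r\<in>code_fixpoints c. s * c i = int r \<or> s * c i = - int r)"
proof (cases rule: is_code_cases[OF assms(1), of i])
  case (2 r)
  then have "r \<in> code_fixpoints c" by (simp add: code_fixpoints_def)
  then show ?thesis using 2(4) assms(2) by auto
next
  case (3 r)
  then have "r \<in> code_fixpoints c" by (simp add: code_fixpoints_def)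
  then show ?thesis using 3(4) assms(2) by auto
qed simp

text \<open>A code on \<open>Suc m\<close> indices amounts to its restriction together with its last
  entry, and being below \<open>c\<close> constrains that entry only through
  \<open>c (Suc m)\<close>.\<close>

lemma codes_below_Suc:
  assumes c: "is_code c"
  shows "codes_below c (Suc m) =
    (\<lambda>(c', v). c'(Suc m := v)) ` (SIGMA c':codes_below c m. code_choices c m c')"
proof (intro set_eqI iffI)
  fix c' assume c': "c' \<in> codes_below c (Suc m)"
  then have cs: "c' \<in> codes (Suc m)" and below: "\<And>i. i \<le> Suc m \<Longrightarrow> c' i = sgn (c i) * c' (nat \<bar>c i\<bar>)"
    using codes_belowD by blast+
  let ?b = "c'(Suc m := 0)"
  have le: "nat \<bar>c i\<bar> \<le> i" for i using c by (rule is_codeD)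
  have b: "?b \<in> codes_below c m"
    unfolding codes_below_def
  proof (intro CollectI conjI allI impI)
    show "?b \<in> codes m" by (rule codes_restrict(1)[OF cs])
    fix i assume "i \<le> m"
    then show "?b i = sgn (c i) * ?b (nat \<bar>c i\<bar>)"
      using below[of i] le[of i] by (metis Suc_n_not_le_n fun_upd_other le_SucI order_trans)
  qed
  have "c' (Suc m) \<in> code_choices c m ?b"
  proof (cases "c (Suc m) = int (Suc m)")
    case True
    then show ?thesis using codes_restrict(2)[OF cs] by (auto simp: code_choices_def)
  next
    case False
    \<comment> \<open>The label is then a smaller index, so clearing entry \<open>Suc m\<close> does
      not change the value at the label.\<close>
    then have "nat \<bar>c (Suc m)\<bar> \<noteq> Suc m"
      using is_code_abs_eq[OF c, of "Suc m"] by auto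
    then have "code_choices c m ?b = {sgn (c (Suc m)) * c' (nat \<bar>c (Suc m)\<bar>)}"
      using False by (simp add: code_choices_def)
    then show ?thesis using below[of "Suc m"] by blast
  qed
  then show "c' \<in> (\<lambda>(c', v). c'(Suc m := v)) ` (SIGMA c':codes_below c m. code_choices c m c')"
    using b by (intro image_eqI[of _ _ "(?b, c' (Suc m))"]) auto
next
  fix d assume "d \<in> (\<lambda>(c', v). c'(Suc m := v)) ` (SIGMA c':codes_below c m. code_choices c m c')"
  then obtain c' v where d: "d = c'(Suc m := v)" and b: "c' \<in> codes_below c m"
    and v: "v \<in> code_choices c m c'" by auto
  have cs: "c' \<in> codes m" and below: "\<And>i. i \<le> m \<Longrightarrow> c' i = sgn (c i) * c' (nat \<bar>c i\<bar>)"
    using b codes_belowD by blast+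
  have le: "nat \<bar>c i\<bar> \<le> i" for i using c by (rule is_codeD)
  have "d \<in> codes (Suc m)"
  proof (cases "c (Suc m) = int (Suc m)")
    case True
    then show ?thesis using v unfolding d
      by (intro codes_upd[OF cs]) (auto simp: code_choices_def)
  next
    case False
    then have "v = sgn (c (Suc m)) * c' (nat \<bar>c (Suc m)\<bar>)"
      using v by (auto simp: code_choices_def)
    moreover have "is_code c'" using cs by (auto simp: codes_def)
    ultimately show ?thesis unfolding d
      using is_code_value_choices[of c' "sgn (c (Suc m))" "nat \<bar>c (Suc m)\<bar>"]
      by (intro codes_upd[OF cs]) (auto simp: sgn_if)
  qed
  moreover have "d i = sgn (c i) * d (nat \<bar>c i\<bar>)" if "i \<le> Suc m" for i
  proof (cases "i = Suc m")
    case True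
    show ?thesis
    proof (cases "c (Suc m) = int (Suc m)")
      case c_fix: True
      then have "nat \<bar>c i\<bar> = i" "sgn (c i) = 1" using True by simp_all
      then show ?thesis by simp
    next
      case False
      then have "nat \<bar>c (Suc m)\<bar> \<noteq> Suc m"
        using is_code_abs_eq[OF c, of "Suc m"] by auto
      then show ?thesis using False True v d by (auto simp: code_choices_def)
    qed
  next
    case False
    with that have "i \<le> m" by simp
    then show ?thesis using below[of i] le[of i] unfolding d
      by (metis Suc_n_not_le_n fun_upd_other order_trans)
  qed
  ultimately show "d \<in> codes_below c (Suc m)" unfolding codes_below_def by blast
qed

section \<open>Summing over codes by their number of fixed indices\<close>

lemma finite_code_choices: "c' \<in> codes m \<Longrightarrow> finite (code_choices c m c')"
  by (auto simp: code_choices_def finite_code_fixpoints)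

lemma finite_codes_below: "is_code c \<Longrightarrow> finite (codes_below c n)"
proof (induction n)
  case (Suc n)
  then show ?case unfolding codes_below_Suc[OF Suc.prems]
    by (intro finite_imageI finite_SigmaI) (auto intro: finite_code_choices codes_belowD)
qed (simp add: codes_below_0)

lemma finite_codes: "finite (codes n)"
  using finite_codes_below[OF is_code_int] by (simp add: codes_below_int)

text \<open>With \<open>k = nfix c'\<close>, the values 0 and plus or minus a fixed index are 2k + 1
  distinct labels that leave \<open>nfix\<close> unchanged; only \<open>Suc m\<close> itself raises
  it.\<close>

lemma sum_code_choices:
  fixes \<phi> :: "nat \<Rightarrow> 'a::comm_ring_1"
  assumes c': "c' \<in> codes m" and c: "c (Suc m) = int (Suc m)"
  shows "(\<Sum>v\<in>code_choices c m c'. \<phi> (nfix (c'(Suc m := v)))) =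
    of_nat (2 * nfix c' + 1) * \<phi> (nfix c') + \<phi> (Suc (nfix c'))"
proof -
  let ?F = "code_fixpoints c'"
  let ?P = "int ` ?F" and ?N = "(\<lambda>r. - int r) ` ?F"
  let ?R = "insert 0 (?P \<union> ?N)"
  have fin: "finite ?F" and sub: "?F \<subseteq> {1..m}"
    using c' finite_code_fixpoints code_fixpoints_subset by auto
  have notin: "int (Suc m) \<notin> ?R" using sub by auto
  have "card (?P \<union> ?N) = card ?P + card ?N"
    using fin sub by (intro card_Un_disjoint) auto
  also have "\<dots> = 2 * nfix c'"
    by (simp add: card_image inj_on_def nfix_def)
  finally have "card ?R = 2 * nfix c' + 1"
    using sub fin by (subst card_insert_disjoint) auto
  moreover have "(\<Sum>v\<in>?R. \<phi> (nfix (c'(Suc m := v)))) = (\<Sum>v\<in>?R. \<phi> (nfix c'))"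
    using notin by (intro sum.cong refl) (auto simp: nfix_upd[OF c'])
  ultimately have "(\<Sum>v\<in>?R. \<phi> (nfix (c'(Suc m := v)))) = of_nat (2 * nfix c' + 1) * \<phi> (nfix c')"
    by simp
  moreover have "code_choices c m c' = insert (int (Suc m)) ?R"
    using c by (simp add: code_choices_def)
  ultimately show ?thesis
    using fin notin by (simp add: nfix_upd[OF c'])
qed

lemma sum_codes_below_Suc:
  fixes \<phi> :: "nat \<Rightarrow> 'a::comm_ring_1"
  assumes c: "is_code c"
  shows "(\<Sum>d\<in>codes_below c (Suc m). \<phi> (nfix d)) =
    (if c (Suc m) = int (Suc m)
     then \<Sum>d\<in>codes_below c m. of_nat (2 * nfix d + 1) * \<phi> (nfix d) + \<phi> (Suc (nfix d))
     else \<Sum>d\<in>codes_below c m. \<phi> (nfix d))"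
proof -
  have codes: "d \<in> codes m" if "d \<in> codes_below c m" for d
    using that by (rule codes_belowD)
  \<comment> \<open>All codes in \<open>codes m\<close> vanish at \<open>Suc m\<close>, so an
    extension determines both the code and the added value.\<close>
  have inj: "inj_on (\<lambda>(c', v). c'(Suc m := v)) (SIGMA c':codes_below c m. code_choices c m c')"
  proof (rule inj_onI, clarify)
    fix c1 v1 c2 v2
    assume a: "c1 \<in> codes_below c m" "c2 \<in> codes_below c m" and eq: "c1(Suc m := v1) = c2(Suc m := v2)"
    have "c1 (Suc m) = c2 (Suc m)" using codes[OF a(1)] codes[OF a(2)] by (simp add: codes_def)
    then show "c1 = c2 \<and> v1 = v2" using eq by (metis fun_upd_eqD fun_upd_triv fun_upd_upd)
  qed
  have "(\<Sum>d\<in>codes_below c (Suc m). \<phi> (nfix d)) =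
      (\<Sum>(d, v)\<in>(SIGMA c':codes_below c m. code_choices c m c'). \<phi> (nfix (d(Suc m := v))))"
    unfolding codes_below_Suc[OF c] by (subst sum.reindex[OF inj]) (simp add: case_prod_unfold)
  also have "\<dots> = (\<Sum>d\<in>codes_below c m. \<Sum>v\<in>code_choices c m d. \<phi> (nfix (d(Suc m := v))))"
    by (rule sum.Sigma[symmetric])
      (auto intro: finite_codes_below finite_code_choices c codes)
  finally have *: "(\<Sum>d\<in>codes_below c (Suc m). \<phi> (nfix d)) = \<dots>" .
  show ?thesis
  proof (cases "c (Suc m) = int (Suc m)")
    case True
    then show ?thesis unfolding * using sum_code_choices[OF codes, of _ c \<phi>]
      by (auto intro!: sum.cong)
  next
    case False
    have "(\<Sum>v\<in>code_choices c m d. \<phi> (nfix (d(Suc m := v)))) = \<phi> (nfix d)"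
      if d: "d \<in> codes_below c m" for d
    proof -
      \<comment> \<open>Entries of \<open>d\<close> are at most \<open>m\<close> in absolute value,
        so a forced entry never creates a new fixed index.\<close>
      have "d i \<noteq> int (Suc m) \<and> - d i \<noteq> int (Suc m)" for i
      proof -
        have "is_code d" using codes[OF d] by (simp add: codes_def)
        then show ?thesis
          using code_fixpoints_subset[OF codes[OF d]]
          by (cases rule: is_code_cases[of d i]) (auto simp: code_fixpoints_def subset_iff)
      qed
      then have "sgn (c (Suc m)) * d (nat \<bar>c (Suc m)\<bar>) \<noteq> int (Suc m)"
        by (auto simp: sgn_if)
      then show ?thesis using False by (simp add: code_choices_def nfix_upd[OF codes[OF d]])
    qed
    with False show ?thesis unfolding * by simp
  qed
qed

text \<open>Strong induction on the index: if one of the codes has a smaller label at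
  \<open>i\<close>, both entries are the same signed multiple of entries already known to agree;
  otherwise \<open>i\<close> is fixed by both.\<close>

lemma codes_below_antisym:
  assumes "c \<in> codes_below c' n" "c' \<in> codes_below c n"
  shows "c = c'"
proof
  fix i show "c i = c' i"
  proof (induction i rule: less_induct)
    case (less i)
    have red: "is_code c" "is_code c'"
      using codes_belowD(1)[OF assms(1)] codes_belowD(1)[OF assms(2)] by (simp_all add: codes_def)
    consider "i > n" | "i \<le> n" "nat \<bar>c i\<bar> < i" | "i \<le> n" "nat \<bar>c' i\<bar> < i"
      | "nat \<bar>c i\<bar> = i" "nat \<bar>c' i\<bar> = i"
      using is_codeD(1)[OF red(1), of i] is_codeD(1)[OF red(2), of i] by linarith
    then show ?case
    proof cases
      case 1
      then show ?thesis
        using codes_belowD(1)[OF assms(1)] codes_belowD(1)[OF assms(2)] by (simp add: codes_def)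
    next
      case 2
      then show ?thesis
        using less[of "nat \<bar>c i\<bar>"] codes_belowD(2)[OF assms(2), of i] is_codeD(2)[OF red(1), of i]
        by metis
    next
      case 3
      then show ?thesis
        using less[of "nat \<bar>c' i\<bar>"] codes_belowD(2)[OF assms(1), of i] is_codeD(2)[OF red(2), of i]
        by metis
    next
      case 4
      then show ?thesis
        using is_code_abs_eq[OF red(1)] is_code_abs_eq[OF red(2)] by metis
    qed
  qed
qed

text \<open>The double factorial (2k-1)!!, equal to 1 for \<open>k = 0\<close>.\<close>

definition odd_fact :: "nat \<Rightarrow> int" where
  "odd_fact k = (\<Prod>i<k. 2 * int i + 1)"

text \<open>At an index fixed by \<open>c\<close> the 2k + 1 old labels cancel against the new one,
  since \<open>odd_fact (Suc k)\<close> is (2k + 1) times \<open>odd_fact k\<close> and the sign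
  changes. At any other index the sum is unchanged, so without fixed indices the initial value 1
  survives.\<close>

lemma sum_codes_below_odd_fact:
  assumes c: "is_code c"
  shows "(\<Sum>d\<in>codes_below c m. (-1) ^ nfix d * odd_fact (nfix d)) =
    (if \<exists>i\<in>{1..m}. c i = int i then 0 else 1)"
proof (induction m)
  case 0
  have "code_fixpoints (\<lambda>_. 0) = {}" by (auto simp: code_fixpoints_def)
  then show ?case using c by (simp add: codes_below_0 odd_fact_def nfix_def)
next
  case (Suc m)
  have "int (2 * k + 1) * ((-1) ^ k * odd_fact k) + (-1) ^ Suc k * odd_fact (Suc k) = 0" for k
    by (simp add: odd_fact_def algebra_simps)
  then show ?case
    using Suc sum_codes_below_Suc[OF c, of "\<lambda>k. (-1) ^ k * odd_fact k" m]
    by (auto simp: atLeastAtMostSuc_conv simp del: power_Suc)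
qed

lemma sum_codes_Suc:
  fixes \<phi> :: "nat \<Rightarrow> 'a::comm_ring_1"
  shows "(\<Sum>d\<in>codes (Suc m). \<phi> (nfix d)) =
    (\<Sum>d\<in>codes m. of_nat (2 * nfix d + 1) * \<phi> (nfix d) + \<phi> (Suc (nfix d)))"
  using sum_codes_below_Suc[OF is_code_int, of \<phi> m] by (simp add: codes_below_int)

section \<open>Flats and their Moebius function\<close>

text \<open>Codes need least indices while the index type carries no order, so an arbitrary
  numbering from 1 is chosen.\<close>

definition idx :: "'n::finite \<Rightarrow> nat" where
  "idx = (SOME f. bij_betw f UNIV {1..CARD('n)})"

lemma bij_idx: "bij_betw (idx :: 'n::finite \<Rightarrow> nat) UNIV {1..CARD('n)}"
proof -
  obtain h where "bij_betw h {1..CARD('n)} (UNIV :: 'n set)"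
    using ex_bij_betw_nat_finite_1[of "UNIV :: 'n set"] by auto
  then have "bij_betw (inv_into {1..CARD('n)} h) UNIV {1..CARD('n)}"
    by (rule bij_betw_inv_into)
  then show ?thesis unfolding idx_def
    by (rule someI[where P = "\<lambda>f. bij_betw f UNIV {1..CARD('n)}"])
qed

lemma inj_idx: "inj idx"
  using bij_idx by (auto simp: bij_betw_def)

lemma idx_eq_iff [simp]: "idx i = idx j \<longleftrightarrow> i = j"
  using inj_idx by (auto simp: inj_def)

lemma range_idx: "range (idx :: 'n::finite \<Rightarrow> nat) = {1..CARD('n)}"
  using bij_idx by (auto simp: bij_betw_def)

lemma idx_bounds: "0 < idx i" "idx (i :: 'n::finite) \<le> CARD('n)"
  using range_idx[where ?'n = 'n] by (auto simp: set_eq_iff image_iff Suc_le_eq)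

lemma ex_idx:
  assumes "0 < k" "k \<le> CARD('n::finite)"
  obtains i :: "'n::finite" where "k = idx i"
  using range_idx[where ?'n = 'n] assms by (auto simp: set_eq_iff image_iff Suc_le_eq)

text \<open>The coordinate with index 0 is constantly 0, which treats the hyperplanes $x_i = 0$ and
  $x_i = x_j$ alike.\<close>
definition crd :: "real ^ 'n::finite \<Rightarrow> nat \<Rightarrow> real" where
  "crd x k = (\<Sum>i | idx i = k. x $ i)"

lemma crd_idx [simp]: "crd x (idx i) = x $ i"
  by (simp add: crd_def)

lemma crd_outside: "\<not> (0 < k \<and> k \<le> CARD('n)) \<Longrightarrow> crd (x :: real ^ 'n::finite) k = 0"
  unfolding crd_def using idx_bounds[where ?'n = 'n] by (metis (mono_tags) mem_Collect_eq sum.neutral)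

lemma crd_0 [simp]: "crd x 0 = 0"
  by (simp add: crd_outside)

definition flat :: "(nat \<Rightarrow> int) \<Rightarrow> (real ^ 'n::finite) set" where
  "flat c = {x. \<forall>k. crd x k = of_int (sgn (c k)) * crd x (nat \<bar>c k\<bar>)}"

text \<open>A generic point of the flat: among the flats of codes, it lies exactly in those
  containing the whole flat.\<close>

definition code_vec :: "(nat \<Rightarrow> int) \<Rightarrow> real ^ 'n::finite" where
  "code_vec c = (\<chi> i. of_int (c (idx i)))"

lemma flatD: "x \<in> flat c \<Longrightarrow> crd x k = of_int (sgn (c k)) * crd x (nat \<bar>c k\<bar>)"
  unfolding flat_def by blast

lemma flatI:
  assumes "c \<in> codes CARD('n)"
    and "\<And>i. x $ i = of_int (sgn (c (idx i))) * crd x (nat \<bar>c (idx i)\<bar>)"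
  shows "x \<in> (flat c :: (real ^ 'n::finite) set)"
  unfolding flat_def
proof (intro CollectI allI)
  fix k
  show "crd x k = of_int (sgn (c k)) * crd x (nat \<bar>c k\<bar>)"
  proof (cases "0 < k \<and> k \<le> CARD('n)")
    case True
    then obtain i :: 'n where "k = idx i" using ex_idx by metis
    then show ?thesis using assms(2)[of i] by simp
  next
    case False
    then have "c k = 0" using assms(1) is_code_0[of c] by (auto simp: codes_def)
    then show ?thesis using False by (simp add: crd_outside)
  qed
qed

lemma crd_code_vec:
  assumes "c \<in> codes CARD('n)"
  shows "crd (code_vec c :: real ^ 'n::finite) k = of_int (c k)"
proof (cases "0 < k \<and> k \<le> CARD('n)")
  case True
  then obtain i :: 'n where "k = idx i" using ex_idx by metis
  then show ?thesis by (simp add: code_vec_def)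
next
  case False
  then have "c k = 0" using assms is_code_0[of c] by (auto simp: codes_def)
  then show ?thesis using False by (simp add: crd_outside)
qed

section \<open>Codes as an order-preserving parametrization of the flats\<close>

lemma code_vec_in_flat_iff:
  assumes "c' \<in> codes CARD('n)" "c \<in> codes CARD('n)"
  shows "(code_vec c' :: real ^ 'n::finite) \<in> flat c \<longleftrightarrow> c' \<in> codes_below c CARD('n)"
proof -
  have "(code_vec c' :: real ^ 'n) \<in> flat c \<longleftrightarrow> (\<forall>k. c' k = sgn (c k) * c' (nat \<bar>c k\<bar>))"
    unfolding flat_def mem_Collect_eq crd_code_vec[OF assms(1)]
    by (simp only: of_int_mult[symmetric] of_int_eq_iff)
  also have "\<dots> \<longleftrightarrow> (\<forall>k\<le>CARD('n). c' k = sgn (c k) * c' (nat \<bar>c k\<bar>))"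
  proof -
    have "c' k = sgn (c k) * c' (nat \<bar>c k\<bar>)" if "\<not> k \<le> CARD('n)" for k
      using that assms by (simp add: codes_def)
    then show ?thesis by blast
  qed
  also have "\<dots> \<longleftrightarrow> c' \<in> codes_below c CARD('n)"
    unfolding codes_below_def using assms(1) by blast
  finally show ?thesis .
qed

lemma codes_below_refl: "c \<in> codes n \<Longrightarrow> c \<in> codes_below c n"
  unfolding codes_below_def codes_def is_code_def by blast

text \<open>One direction tests the inclusion on the generic point \<open>code_vec c'\<close>; the
  other composes the relations of \<open>c'\<close> at an index and at its label under
  \<open>c\<close>.\<close>

lemma flat_subset_iff:
  assumes "c' \<in> codes CARD('n)" "c \<in> codes CARD('n)"
  shows "(flat c' :: (real ^ 'n::finite) set) \<subseteq> flat c \<longleftrightarrow> c' \<in> codes_below c CARD('n)"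
proof
  assume "(flat c' :: (real ^ 'n) set) \<subseteq> flat c"
  moreover have "(code_vec c' :: real ^ 'n) \<in> flat c'"
    using code_vec_in_flat_iff[OF assms(1) assms(1)] codes_below_refl[OF assms(1)] by blast
  ultimately show "c' \<in> codes_below c CARD('n)" using code_vec_in_flat_iff[OF assms] by blast
next
  assume below: "c' \<in> codes_below c CARD('n)"
  show "(flat c' :: (real ^ 'n) set) \<subseteq> flat c"
  proof (intro subsetI flatI assms)
    fix x :: "real ^ 'n" and i :: 'n assume x: "x \<in> flat c'"
    let ?k = "idx i"
    let ?r = "nat \<bar>c ?k\<bar>"
    have k: "c' ?k = sgn (c ?k) * c' ?r"
      by (rule codes_belowD(2)[OF below idx_bounds(2)])
    have "x $ i = of_int (sgn (c' ?k)) * crd x (nat \<bar>c' ?k\<bar>)"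
      using flatD[OF x, of ?k] by simp
    \<comment> \<open>The entries \<open>c' ?k\<close> and \<open>c' ?r\<close> have the same label
      up to a sign factor, or the factor is 0.\<close>
    also have "\<dots> = of_int (sgn (c ?k)) * (of_int (sgn (c' ?r)) * crd x (nat \<bar>c' ?r\<bar>))"
      unfolding k by (cases "c ?k = 0") (simp_all add: sgn_mult abs_mult abs_sgn_eq)
    also have "\<dots> = of_int (sgn (c ?k)) * crd x ?r"
      using flatD[OF x, of ?r] by simp
    finally show "x $ i = of_int (sgn (c ?k)) * crd x ?r" .
  qed
qed

lemma inj_on_flat: "inj_on (flat :: _ \<Rightarrow> (real ^ 'n::finite) set) (codes CARD('n))"
proof (rule inj_onI)
  fix c c' assume c: "c \<in> codes CARD('n)" "c' \<in> codes CARD('n)"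
    and "(flat c :: (real ^ 'n) set) = flat c'"
  then have "c \<in> codes_below c' CARD('n)" "c' \<in> codes_below c CARD('n)"
    using flat_subset_iff[where ?'n = 'n] c by blast+
  then show "c = c'" by (rule codes_below_antisym)
qed

text \<open>One hyperplane per index that is not its own label suffices; the equation at any other
  index holds trivially.\<close>

lemma flat_in_B_flats:
  assumes c: "c \<in> codes CARD('n)"
  shows "(flat c :: (real ^ 'n::finite) set) \<in> B_flats"
proof -
  define H where "H i = {x :: real ^ 'n. x $ i = of_int (sgn (c (idx i))) * crd x (nat \<bar>c (idx i)\<bar>)}" for i
  have red: "is_code c" using c by (simp add: codes_def)
  have "H i \<in> B_hyperplanes" if "c (idx i) \<noteq> int (idx i)" for i
  proof (cases rule: is_code_cases[OF red, of "idx i"])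
    case 1
    then have "H i = {x. x $ i = 0}" by (simp add: H_def)
    then show ?thesis unfolding B_hyperplanes_def by blast
  next
    case (2 r)
    then have "r \<le> CARD('n)" using idx_bounds(2)[of i] by simp
    then obtain j :: 'n where j: "r = idx j" using 2 ex_idx by metis
    have "H i = {x. x $ i = x $ j}" using 2 j by (simp add: H_def)
    moreover have "i \<noteq> j" using 2 j that by auto
    ultimately show ?thesis unfolding B_hyperplanes_def by blast
  next
    case (3 r)
    then have "r \<le> CARD('n)" using idx_bounds(2)[of i] by simp
    then obtain j :: 'n where j: "r = idx j" using 3 ex_idx by metis
    have "H i = {x. x $ i = - (x $ j)}" using 3 j by (simp add: H_def)
    moreover have "i \<noteq> j" using 3 j by auto
    ultimately show ?thesis unfolding B_hyperplanes_def by blast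
  qed
  then have sub: "H ` {i. c (idx i) \<noteq> int (idx i)} \<subseteq> B_hyperplanes" by auto
  have triv: "x \<in> H i" if "c (idx i) = int (idx i)" for x i
    using that idx_bounds(1)[of i] by (simp add: H_def)
  have "flat c = \<Inter> (H ` {i. c (idx i) \<noteq> int (idx i)})"
  proof (intro set_eqI iffI)
    fix x :: "real ^ 'n" assume "x \<in> flat c"
    then have "x \<in> H i" for i using flatD[of x c "idx i"] by (simp add: H_def)
    then show "x \<in> \<Inter> (H ` {i. c (idx i) \<noteq> int (idx i)})" by blast
  next
    fix x assume "x \<in> \<Inter> (H ` {i. c (idx i) \<noteq> int (idx i)})"
    then have "x \<in> H i" for i using triv[of i x] by blast
    then show "x \<in> flat c" by (intro flatI c) (simp add: H_def)
  qed
  then show ?thesis using sub unfolding B_flats_def by blast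
qed

text \<open>The coordinates that agree up to sign on all of \<open>X\<close> form classes, and the
  code is read off from the least member of each class.\<close>

lemma B_flats_subset:
  assumes "X \<in> (B_flats :: (real ^ 'n::finite) set set)"
  shows "X \<in> flat ` codes CARD('n)"
proof -
  obtain S where S: "S \<subseteq> B_hyperplanes" and X: "X = \<Inter> S"
    using assms unfolding B_flats_def by blast
  define pos where "pos i j \<longleftrightarrow> (\<forall>x\<in>X. crd x i = crd x j)" for i j
  define neg where "neg i j \<longleftrightarrow> (\<forall>x\<in>X. crd x i = - crd x j)" for i j
  \<comment> \<open>Index 0 competes for the minimum, so coordinates vanishing on \<open>X\<close>
    receive label 0.\<close>
  define rep where "rep i = (LEAST r. pos i r \<or> neg i r)" for i
  define c where "c i = (if pos i (rep i) then int (rep i) else - int (rep i))" for i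
  have rep: "pos i (rep i) \<or> neg i (rep i)" for i
    unfolding rep_def by (rule LeastI[of _ i]) (simp add: pos_def)
  have rep_le: "rep i \<le> r" if "pos i r \<or> neg i r" for i r
    unfolding rep_def using that by (rule Least_le)
  have rep_cong: "rep i = rep j" if "pos i j \<or> neg i j" for i j
  proof -
    have "(pos i r \<or> neg i r) = (pos j r \<or> neg j r)" for r
      using that by (auto simp: pos_def neg_def)
    then show ?thesis by (simp add: rep_def)
  qed
  \<comment> \<open>A coordinate equal to both a value and its negative is 0, hence belongs to the
    class of index 0.\<close>
  have not_both: "rep i = 0" if "pos i (rep i)" "neg i (rep i)" for i
  proof -
    have "pos i 0" using that by (force simp: pos_def neg_def)
    then show ?thesis using rep_le[of i 0] by simp
  qed
  have c_pos: "c i = c j" if "pos i j" for i j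
  proof -
    have "pos i r = pos j r" for r using that by (auto simp: pos_def)
    then show ?thesis using rep_cong[of i j] that by (simp add: c_def)
  qed
  have c_neg: "c i = - c j" if "neg i j" for i j
  proof (cases "rep i = 0")
    case True
    then show ?thesis using rep_cong[of i j] that by (simp add: c_def)
  next
    case False
    have e: "rep i = rep j" using rep_cong[of i j] that by simp
    \<comment> \<open>Passing from \<open>i\<close> to \<open>j\<close> exchanges \<open>pos\<close>
      and \<open>neg\<close>, and at a nonzero label exactly one of them holds.\<close>
    have "pos i r = neg j r" "neg i r = pos j r" for r
      using that by (force simp: pos_def neg_def)+
    then have "pos i (rep i) \<longleftrightarrow> \<not> pos j (rep j)"
      using rep[of j] not_both[of j] False e by auto
    then show ?thesis using e by (simp add: c_def)
  qed
  have crd_X: "crd x i = of_int (sgn (c i)) * crd x (nat \<bar>c i\<bar>)" if "x \<in> X" for x i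
    using rep[of i] that by (cases "rep i = 0") (auto simp: c_def pos_def neg_def)
  have "is_code c"
  proof (rule is_codeI)
    fix i
    show "c i = 0 \<or> (\<exists>r\<in>code_fixpoints c. r \<le> i \<and> (c i = int r \<or> c i = - int r))"
    proof (cases "rep i = 0")
      case False
      have "rep (rep i) = rep i" using rep_cong[OF rep[of i]] by simp
      moreover have "pos (rep i) (rep i)" by (simp add: pos_def)
      ultimately have "rep i \<in> code_fixpoints c" using False by (simp add: code_fixpoints_def c_def)
      moreover have "rep i \<le> i" using rep_le[of i i] by (simp add: pos_def)
      ultimately show ?thesis by (auto simp: c_def)
    qed (simp add: c_def)
  qed
  moreover have "c i = 0" if "i > CARD('n)" for i
  proof -
    have "pos i 0" using that by (simp add: pos_def crd_outside)
    then show ?thesis using rep_le[of i 0] by (simp add: c_def)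
  qed
  ultimately have codes: "c \<in> codes CARD('n)" by (simp add: codes_def)
  have "X = flat c"
  proof (intro subset_antisym subsetI)
    fix x assume "x \<in> X"
    then show "x \<in> flat c" unfolding flat_def using crd_X by blast
  next
    fix x :: "real ^ 'n" assume x: "x \<in> flat c"
    show "x \<in> X" unfolding X
    proof
      fix K assume "K \<in> S"
      \<comment> \<open>Since \<open>X\<close> lies in \<open>K\<close>, the equation of
        \<open>K\<close> is one of the relations recorded by \<open>pos\<close> or
        \<open>neg\<close>, and every point of \<open>flat c\<close> inherits it through the entries
        of \<open>c\<close>.\<close>
      then have "K \<in> B_hyperplanes" and XK: "X \<subseteq> K" using S X by auto
      then consider i j where "K = {x. x $ i = x $ j}" | i j where "K = {x. x $ i = - (x $ j)}"
        | i where "K = {x. x $ i = 0}" unfolding B_hyperplanes_def by blast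
      then show "x \<in> K"
      proof cases
        case 1
        then have "c (idx i) = c (idx j)" using XK by (intro c_pos) (auto simp: pos_def)
        then have "crd x (idx i) = crd x (idx j)" using flatD[OF x] by metis
        then show ?thesis using 1 by simp
      next
        case 2
        then have "c (idx i) = - c (idx j)" using XK by (intro c_neg) (auto simp: neg_def)
        then have "crd x (idx i) = - crd x (idx j)"
          using flatD[OF x, of "idx i"] flatD[OF x, of "idx j"] by simp
        then show ?thesis using 2 by simp
      next
        case 3
        then have "pos (idx i) 0" using XK by (auto simp: pos_def)
        then have "c (idx i) = 0" using rep_le[of "idx i" 0] by (simp add: c_def)
        then show ?thesis using flatD[OF x, of "idx i"] 3 by simp
      qed
    qed
  qed
  then show ?thesis using codes by blast
qed

lemma B_flats_eq: "(B_flats :: (real ^ 'n::finite) set set) = flat ` codes CARD('n)"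
  using flat_in_B_flats B_flats_subset by blast

text \<open>Coordinates at fixed indices can be prescribed freely and determine the others. So the
  flat is the image of the coordinate subspace \<open>E\<close> under a linear map \<open>f\<close>
  that is injective on \<open>E\<close> and fills each coordinate from its label.\<close>

lemma dim_flat:
  assumes c: "c \<in> codes CARD('n)"
  shows "dim (flat c :: (real ^ 'n::finite) set) = nfix c"
proof -
  define F where "F = {i :: 'n. c (idx i) = int (idx i)}"
  define E where "E = {x :: real ^ 'n. \<forall>i. i \<notin> F \<longrightarrow> x $ i = 0}"
  define f :: "real ^ 'n \<Rightarrow> real ^ 'n"
    where "f x = (\<chi> i. of_int (sgn (c (idx i))) * crd x (nat \<bar>c (idx i)\<bar>))" for x
  have red: "is_code c" using c by (simp add: codes_def)
  have lin: "linear f"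
    by (rule linearI)
      (simp_all add: f_def vec_eq_iff crd_def sum.distrib sum_distrib_left distrib_left mult.left_commute)
  have f_F: "f x $ i = x $ i" if "i \<in> F" for x i
    using that idx_bounds(1)[of i] by (simp add: f_def F_def)
  have rep: "c (idx i) = 0 \<or> (\<exists>j\<in>F. nat \<bar>c (idx i)\<bar> = idx j)" for i :: 'n
  proof (cases rule: is_code_cases[OF red, of "idx i"])
    case (2 r)
    then have "r \<le> CARD('n)" using idx_bounds(2)[of i] by simp
    then obtain j :: 'n where "r = idx j" using 2 ex_idx by metis
    then show ?thesis using 2 by (auto simp: F_def)
  next
    case (3 r)
    then have "r \<le> CARD('n)" using idx_bounds(2)[of i] by simp
    then obtain j :: 'n where "r = idx j" using 3 ex_idx by metis
    then show ?thesis using 3 by (auto simp: F_def)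
  qed simp
  have f_cong: "f x = f y" if "\<And>i. i \<in> F \<Longrightarrow> x $ i = y $ i" for x y
    unfolding vec_eq_iff
  proof
    fix i show "f x $ i = f y $ i" using rep[of i] that by (auto simp: f_def)
  qed
  have f_flat: "f x \<in> flat c" for x
  proof (rule flatI[OF c])
    fix i
    show "f x $ i = of_int (sgn (c (idx i))) * crd (f x) (nat \<bar>c (idx i)\<bar>)"
    proof (cases "c (idx i) = 0")
      case False
      then obtain j where "j \<in> F" "nat \<bar>c (idx i)\<bar> = idx j" using rep by blast
      then show ?thesis using f_F[of j x] by (simp add: f_def)
    qed (simp add: f_def)
  qed
  have "f ` E = flat c"
  proof (intro subset_antisym subsetI)
    fix y :: "real ^ 'n" assume y: "y \<in> flat c"
    define x where "x = (\<chi> i. if i \<in> F then y $ i else 0)"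
    have "f x = f y" by (rule f_cong) (simp add: x_def)
    also have "\<dots> = y" unfolding vec_eq_iff using flatD[OF y] by (metis crd_idx f_def vec_lambda_beta)
    finally show "y \<in> f ` E" by (intro image_eqI[of _ _ x]) (auto simp: E_def x_def)
  qed (use f_flat in auto)
  moreover have "inj_on f E"
  proof (rule inj_onI)
    fix x y assume "x \<in> E" "y \<in> E" "f x = f y"
    then show "x = y" unfolding vec_eq_iff using f_F E_def by (metis (mono_tags, lifting) mem_Collect_eq)
  qed
  \<comment> \<open>The dimension of the image is obtained from injectivity on the span of
    \<open>E\<close>.\<close>
  moreover have "span E = E" unfolding span_eq_iff E_def subspace_def by simp
  ultimately have "dim (flat c :: (real ^ 'n) set) = dim E"
    by (metis dim_image_eq[OF lin, of E])
  also have "\<dots> = card F" unfolding E_def by (rule dim_substandard_cart[where ?'a = real, unfolded dim_vec_eq])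
  also have "card F = card (idx ` F)" by (rule card_image[symmetric]) (use inj_idx inj_on_subset in blast)
  also have "idx ` F = code_fixpoints c"
  proof (intro subset_antisym subsetI)
    fix k assume "k \<in> idx ` F"
    then show "k \<in> code_fixpoints c" using idx_bounds(1) by (auto simp: F_def code_fixpoints_def)
  next
    fix k assume k: "k \<in> code_fixpoints c"
    then have "0 < k" "k \<le> CARD('n)" using code_fixpoints_subset[OF c] by force+
    then obtain i :: 'n where "k = idx i" using ex_idx by metis
    then show "k \<in> idx ` F" using k by (auto simp: F_def code_fixpoints_def)
  qed
  finally show ?thesis by (simp add: nfix_def)
qed

section \<open>Moebius values and the Poincare polynomial\<close>

lemma B_bot_eq: "(B_bot :: (real ^ 'n::finite) set) = {0}"
proof -
  have "x = 0" if "x \<in> (B_bot :: (real ^ 'n) set)" for x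
  proof -
    have "{x. x $ i = 0} \<in> (B_hyperplanes :: (real ^ 'n) set set)" for i
      unfolding B_hyperplanes_def by blast
    then have "x $ i = 0" for i using that unfolding B_bot_def by blast
    then show ?thesis by (simp add: vec_eq_iff)
  qed
  moreover have "(0 :: real ^ 'n) \<in> B_bot" by (auto simp: B_bot_def B_hyperplanes_def)
  ultimately show ?thesis by blast
qed

lemma finite_B_flats: "finite (B_flats :: (real ^ 'n::finite) set set)"
  by (simp add: B_flats_eq finite_codes)

lemma zero_in_flat: "0 \<in> flat c"
  by (simp add: flat_def crd_def)

lemma B_bot_in_B_flats: "(B_bot :: (real ^ 'n::finite) set) \<in> B_flats"
  unfolding B_bot_def B_flats_def by blast

text \<open>The cancellation on codes, carried over to flats by the order isomorphism; it is the
  summation property characterizing the Moebius function from the bottom.\<close>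

lemma sum_flats_below:
  assumes c: "c \<in> codes CARD('n)"
  shows "(\<Sum>u\<in>{u\<in>B_flats. u \<subseteq> (flat c :: (real ^ 'n::finite) set)}. (-1) ^ dim u * odd_fact (dim u)) =
    (if nfix c = 0 then 1 else 0)"
proof -
  have red: "is_code c" using c by (simp add: codes_def)
  have eq: "{u\<in>B_flats. u \<subseteq> (flat c :: (real ^ 'n) set)} = flat ` codes_below c CARD('n)"
    unfolding B_flats_eq using flat_subset_iff[where ?'n = 'n, OF _ c] codes_belowD(1) by blast
  have sub: "codes_below c CARD('n) \<subseteq> codes CARD('n)" using codes_belowD(1) by blast
  have "(\<Sum>u\<in>{u\<in>B_flats. u \<subseteq> (flat c :: (real ^ 'n) set)}. (-1) ^ dim u * odd_fact (dim u)) =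
    (\<Sum>d\<in>codes_below c CARD('n). (-1) ^ nfix d * odd_fact (nfix d))"
    unfolding eq
  proof (subst sum.reindex)
    show "inj_on (flat :: _ \<Rightarrow> (real ^ 'n) set) (codes_below c CARD('n))"
      using inj_on_subset[OF inj_on_flat sub] .
    show "sum ((\<lambda>u. (-1) ^ dim u * odd_fact (dim u)) \<circ> (flat :: _ \<Rightarrow> (real ^ 'n) set)) (codes_below c CARD('n)) =
      (\<Sum>d\<in>codes_below c CARD('n). (-1) ^ nfix d * odd_fact (nfix d))"
      by (intro sum.cong refl) (use sub in \<open>auto simp: dim_flat[where ?'n = 'n]\<close>)
  qed
  also have "\<dots> = (if \<exists>i\<in>{1..CARD('n)}. c i = int i then 0 else 1)"
    by (rule sum_codes_below_odd_fact[OF red])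
  also have "(\<exists>i\<in>{1..CARD('n)}. c i = int i) \<longleftrightarrow> code_fixpoints c \<noteq> {}"
  proof -
    have "i \<in> code_fixpoints c \<longleftrightarrow> i \<in> {1..CARD('n)} \<and> c i = int i" for i
      using code_fixpoints_subset[OF c] by (auto simp: code_fixpoints_def)
    then show ?thesis by blast
  qed
  also have "\<dots> \<longleftrightarrow> nfix c \<noteq> 0"
    using finite_code_fixpoints[OF c] by (simp add: nfix_def)
  finally show ?thesis by simp
qed

text \<open>By \<open>sum_flats_below\<close> the claimed values sum to 0 over the flats inside any
  \<open>X\<close> other than the bottom, so they obey the recursion defining \<open>mobius\<close>.
  Induction runs on the number of flats strictly inside \<open>X\<close>.\<close>

lemma mobius_B_flats:
  assumes "X \<in> (B_flats :: (real ^ 'n::finite) set set)"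
  shows "mobius B_flats B_bot X = (-1) ^ dim X * odd_fact (dim X)"
  using assms
proof (induction "card {u \<in> B_flats. u \<subset> X}" arbitrary: X rule: less_induct)
  case less
  obtain c where c: "c \<in> codes CARD('n)" and X: "X = flat c"
    using less.prems unfolding B_flats_eq by blast
  have bot_le: "B_bot \<subseteq> u" if "u \<in> B_flats" for u :: "(real ^ 'n) set"
    using that zero_in_flat unfolding B_flats_eq B_bot_eq by blast
  let ?m = "\<lambda>u :: (real ^ 'n) set. (-1) ^ dim u * odd_fact (dim u) :: int"
  show ?case
  proof (cases "B_bot = X")
    case True
    then have dim: "dim X = 0" by (auto simp: B_bot_eq)
    have "mobius B_flats B_bot X = 1"
      using True less.prems finite_B_flats[where ?'n = 'n]
      by (subst mobius.simps) (simp del: mobius.simps)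
    then show ?thesis unfolding dim by (simp add: odd_fact_def del: mobius.simps)
  next
    case False
    have "dim X \<noteq> 0" using False zero_in_flat[of c] X unfolding B_bot_eq by (auto simp: dim_eq_0)
    then have tot: "sum ?m {u \<in> B_flats. u \<subseteq> X} = 0"
      using sum_flats_below[OF c] unfolding X dim_flat[OF c] by simp
    have "{u \<in> B_flats. u \<subseteq> X} = insert X {u \<in> B_flats. u \<subset> X}" using less.prems by blast
    then have split: "sum ?m {u \<in> B_flats. u \<subseteq> X} = ?m X + sum ?m {u \<in> B_flats. u \<subset> X}"
      using finite_B_flats[where ?'n = 'n] by simp
    \<comment> \<open>The bottom is the origin, which lies in every flat.\<close>
    have eq: "{u \<in> B_flats. B_bot \<subseteq> u \<and> u \<subset> X} = {u \<in> B_flats. u \<subset> X}" using bot_le by blast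
    have IH: "mobius B_flats B_bot u = ?m u" if u: "u \<in> {u \<in> B_flats. u \<subset> X}" for u
    proof (rule less.hyps)
      have "{v \<in> B_flats. v \<subset> u} \<subset> {v \<in> B_flats. v \<subset> X}" using u by blast
      then show "card {v \<in> B_flats. v \<subset> u} < card {v \<in> B_flats. v \<subset> X}"
        by (intro psubset_card_mono) (use finite_B_flats[where ?'n = 'n] in auto)
    qed (use u in blast)
    have "mobius B_flats B_bot X = - (\<Sum>u\<in>{u \<in> B_flats. B_bot \<subseteq> u \<and> u \<subset> X}. mobius B_flats B_bot u)"
      using False less.prems finite_B_flats[where ?'n = 'n] B_bot_in_B_flats[where ?'n = 'n] bot_le
      by (subst mobius.simps) (simp del: mobius.simps)
    also have "\<dots> = - sum ?m {u \<in> B_flats. u \<subset> X}"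
      unfolding eq using IH by (simp only: sum.cong[OF refl IH])
    finally show ?thesis using tot split by linarith
  qed
qed

lemma odd_fact_pos: "0 < odd_fact k"
  unfolding odd_fact_def by (rule prod_pos) simp

text \<open>Since \<open>odd_fact\<close> is positive, the absolute value removes just the sign of
  the Moebius value, and the sum over flats is reindexed by codes.\<close>

lemma poincare_B_codes:
  fixes z :: "'a::comm_ring_1"
  shows "poincare_B TYPE('n::finite) z =
    (\<Sum>c\<in>codes CARD('n). of_int (odd_fact (nfix c)) * (z - 1) ^ (CARD('n) - nfix c))"
proof -
  have "poincare_B TYPE('n) z = (\<Sum>X\<in>(B_flats :: (real ^ 'n) set set).
      of_int (odd_fact (dim X)) * (z - 1) ^ (CARD('n) - dim X))"
    unfolding poincare_B_def
    by (intro sum.cong refl)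
      (simp add: mobius_B_flats abs_mult power_abs abs_of_pos[OF odd_fact_pos] del: mobius.simps)
  also have "\<dots> = (\<Sum>c\<in>codes CARD('n). of_int (odd_fact (nfix c)) * (z - 1) ^ (CARD('n) - nfix c))"
    unfolding B_flats_eq
    by (subst sum.reindex[OF inj_on_flat]) (simp add: dim_flat[where ?'n = 'n])
  finally show ?thesis .
qed

section \<open>Insertion into words\<close>

text \<open>The first argument is the letter preceding the word; taking it to be 0 realizes the
  convention w(0) = 0.\<close>

fun des_from :: "int \<Rightarrow> int list \<Rightarrow> nat" where
  "des_from p [] = 0"
| "des_from p (x # xs) = (if x < p then 1 else 0) + des_from x xs"

fun maxima_negative :: "int list \<Rightarrow> bool" where
  "maxima_negative [] \<longleftrightarrow> True"
| "maxima_negative (x # xs) \<longleftrightarrow> ((\<forall>y\<in>set xs. \<bar>y\<bar> < \<bar>x\<bar>) \<longrightarrow> x < 0) \<and> maxima_negative xs"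

text \<open>A word of length \<open>n\<close> whose absolute values fill \<open>{1..int n}\<close>
  repeats none of them, so these words are windows of signed permutations.\<close>

definition BW_words :: "nat \<Rightarrow> int list set" where
  "BW_words n = {xs. length xs = n \<and> abs ` set xs = {1..int n} \<and> maxima_negative xs}"

text \<open>The base case offers only -1, because the last letter is always a right-to-left maximum;
  elsewhere both signs are allowed.\<close>

fun insert_one :: "int list \<Rightarrow> int list list" where
  "insert_one [] = [[-1]]"
| "insert_one (y # ys) = (1 # y # ys) # (-1 # y # ys) # map ((#) y) (insert_one ys)"

text \<open>Frees the absolute value 1 without changing signs or comparisons.\<close>
definition spread :: "int \<Rightarrow> int" where
  "spread x = x + sgn x"

lemma spread_less_iff [simp]: "spread x < spread y \<longleftrightarrow> x < y"
  by (auto simp: spread_def sgn_if)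

lemma spread_0 [simp]: "spread 0 = 0"
  by (simp add: spread_def)

lemma abs_spread: "x \<noteq> 0 \<Longrightarrow> \<bar>spread x\<bar> = \<bar>x\<bar> + 1"
  by (auto simp: spread_def sgn_if)

lemma spread_neg_iff [simp]: "spread x < 0 \<longleftrightarrow> x < 0"
  by (auto simp: spread_def sgn_if)

lemma inj_spread: "inj spread"
  by (auto simp: inj_def spread_def sgn_if split: if_splits)

lemma abs_spread_less_iff [simp]: "\<bar>spread x\<bar> < \<bar>spread y\<bar> \<longleftrightarrow> \<bar>x\<bar> < \<bar>y\<bar>"
  by (auto simp: spread_def sgn_if)

lemma ex_spread: "1 < \<bar>y\<bar> \<Longrightarrow> \<exists>x. x \<noteq> 0 \<and> y = spread x"
  by (rule exI[of _ "y - sgn y"]) (auto simp: spread_def sgn_if)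

lemma des_from_spread: "des_from (spread p) (map spread xs) = des_from p xs"
  by (induction xs arbitrary: p) auto

lemma maxima_negative_spread: "maxima_negative (map spread xs) = maxima_negative xs"
  by (induction xs) auto

lemma maxima_negative_last: "maxima_negative xs \<Longrightarrow> xs \<noteq> [] \<Longrightarrow> last xs < 0"
  by (induction xs) auto

text \<open>Here \<open>k\<close> counts the insertions that keep the number of descents: both signs
  in a descent without sign change, both in an ascent from negative to positive, and -1 at the end.
  As the word ends below 0, its descents through 0 outnumber its ascents through 0 by one if
  \<open>p > 0\<close> and equal them if \<open>p < 0\<close>.\<close>

lemma sum_list_insert_one_des:
  fixes \<phi> :: "nat \<Rightarrow> int"
  assumes "\<forall>y\<in>set (p # ys). 1 < \<bar>y\<bar>" "last (p # ys) < 0"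
  defines "d \<equiv> des_from p ys"
  defines "k \<equiv> 2 * int d + (if p < 0 then 1 else -1)"
  shows "(\<Sum>zs\<leftarrow>insert_one ys. \<phi> (des_from p zs)) =
    k * \<phi> d + (2 * int (length ys) + 1 - k) * \<phi> (Suc d)"
  using assms(1,2) unfolding k_def d_def
proof (induction ys arbitrary: p \<phi>)
  case (Cons y ys)
  have e1: "(\<Sum>zs\<leftarrow>insert_one (y # ys). \<phi> (des_from p zs)) =
     \<phi> (des_from p (1 # y # ys)) + \<phi> (des_from p (-1 # y # ys)) +
     (\<Sum>zs\<leftarrow>insert_one ys. \<phi> ((if y < p then 1 else 0) + des_from y zs))"
    by (simp add: o_def)
  \<comment> \<open>The induction hypothesis is used for the function shifted by the possible
    descent from \<open>p\<close> to \<open>y\<close>.\<close>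
  have e2: "(\<Sum>zs\<leftarrow>insert_one ys. \<phi> ((if y < p then 1 else 0) + des_from y zs)) =
     (2 * int (des_from y ys) + (if y < 0 then 1 else -1)) * \<phi> ((if y < p then 1 else 0) + des_from y ys) +
     (2 * int (length ys) + 1 - (2 * int (des_from y ys) + (if y < 0 then 1 else -1))) *
       \<phi> ((if y < p then 1 else 0) + Suc (des_from y ys))"
    using Cons.prems by (intro Cons.IH) auto
  have "1 < \<bar>p\<bar>" "1 < \<bar>y\<bar>" using Cons.prems by auto
  then show ?case unfolding e1 e2
    by (auto simp: algebra_simps abs_if split: if_splits)
qed auto

text \<open>A preceding 0 violates the bound on \<open>p\<close> in the previous lemma, so the front
  is treated separately: there 1 keeps the number of descents and -1 raises it. The previous lemma,
  with the first letter as \<open>p\<close>, counts the remaining insertions.\<close>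

lemma sum_list_insert_one_des_0:
  fixes \<phi> :: "nat \<Rightarrow> int"
  assumes "\<forall>y\<in>set ys. 1 < \<bar>y\<bar>" "ys \<noteq> [] \<longrightarrow> last ys < 0"
  defines "d \<equiv> des_from 0 ys"
  shows "(\<Sum>zs\<leftarrow>insert_one ys. \<phi> (des_from 0 zs)) =
    2 * int d * \<phi> d + (2 * int (length ys) + 1 - 2 * int d) * \<phi> (Suc d)"
proof (cases ys)
  case (Cons y ys')
  have e1: "(\<Sum>zs\<leftarrow>insert_one ys. \<phi> (des_from 0 zs)) =
     \<phi> (des_from 0 (1 # ys)) + \<phi> (des_from 0 (-1 # ys)) +
     (\<Sum>zs\<leftarrow>insert_one ys'. \<phi> ((if y < 0 then 1 else 0) + des_from y zs))"
    by (simp add: o_def Cons)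
  have e2: "(\<Sum>zs\<leftarrow>insert_one ys'. \<phi> ((if y < 0 then 1 else 0) + des_from y zs)) =
     (2 * int (des_from y ys') + (if y < 0 then 1 else -1)) * \<phi> ((if y < 0 then 1 else 0) + des_from y ys') +
    (2 * int (length ys') + 1 - (2 * int (des_from y ys') + (if y < 0 then 1 else -1))) *
       \<phi> ((if y < 0 then 1 else 0) + Suc (des_from y ys'))"
    using assms Cons by (intro sum_list_insert_one_des) auto
  have "1 < \<bar>y\<bar>" using assms Cons by auto
  then show ?thesis unfolding d_def e1 e2 unfolding Cons
    by (auto simp: algebra_simps abs_if split: if_splits)
qed (simp add: d_def)

lemma in_insert_one_iff:
  "zs \<in> set (insert_one ys) \<longleftrightarrow>
     (\<exists>us e vs. ys = us @ vs \<and> zs = us @ e # vs \<and> \<bar>e\<bar> = 1 \<and> (vs = [] \<longrightarrow> e < 0))"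
proof (induction ys arbitrary: zs)
  case Nil
  show ?case by auto
next
  case (Cons y ys)
  note IH = Cons.IH
  show ?case (is "?l \<longleftrightarrow> ?r")
  proof
    assume ?l
    then consider e where "\<bar>e\<bar> = 1" "zs = e # y # ys" | zs' where "zs = y # zs'" "zs' \<in> set (insert_one ys)"
      by force
    then show ?r
    proof cases
      case 1
      then show ?thesis by (intro exI[of _ "[]"] exI[of _ e] exI[of _ "y # ys"]) auto
    next
      case 2
      then obtain us e vs where "ys = us @ vs" "zs' = us @ e # vs" "\<bar>e\<bar> = 1" "vs = [] \<longrightarrow> e < 0"
        using Cons.IH by auto
      then show ?thesis using 2
        by (intro exI[of _ "y # us"] exI[of _ e] exI[of _ vs]) auto
    qed
  next
    assume ?r
    then obtain us e vs where *: "y # ys = us @ vs" "zs = us @ e # vs" "\<bar>e\<bar> = 1" "vs = [] \<longrightarrow> e < 0"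
      by auto
    show ?l
    proof (cases us)
      case Nil
      moreover have "e = 1 \<or> e = -1" using * by linarith
      ultimately show ?thesis using * by auto
    next
      case (Cons u us')
      then have "us' @ e # vs \<in> set (insert_one ys)" using * IH by auto
      then show ?thesis using Cons * by auto
    qed
  qed
qed

text \<open>Deleting the inserted letter recovers the word, so insertions into different words never
  coincide.\<close>

lemma filter_insert_one:
  assumes "\<forall>y\<in>set ys. 1 < \<bar>y\<bar>" "zs \<in> set (insert_one ys)"
  shows "filter (\<lambda>x. \<bar>x\<bar> \<noteq> 1) zs = ys"
proof -
  have "filter (\<lambda>x. \<bar>x\<bar> \<noteq> 1) ys = ys" using assms(1) by (intro filter_True) auto
  then show ?thesis using assms(2) by (auto simp: in_insert_one_iff)
qed

lemma distinct_insert_one: "\<forall>y\<in>set ys. 1 < \<bar>y\<bar> \<Longrightarrow> distinct (insert_one ys)"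
  by (induction ys) (auto simp: distinct_map)

text \<open>The letter \<open>e\<close> is smaller in absolute value than all others, so it affects
  no other maximum and is one itself only at the end.\<close>

lemma maxima_negative_insert:
  assumes "\<forall>y\<in>set (us @ vs). 1 < \<bar>y\<bar>" "\<bar>e\<bar> = 1"
  shows "maxima_negative (us @ e # vs) \<longleftrightarrow> maxima_negative (us @ vs) \<and> (vs = [] \<longrightarrow> e < 0)"
  using assms
proof (induction us)
  case Nil
  then show ?case by (cases vs) force+
qed auto

section \<open>Recursion for descent sums over words\<close>

lemma BW_words_0: "BW_words 0 = {[]}"
  by (auto simp: BW_words_def)

lemma BW_words_spread_gt1:
  assumes "xs \<in> BW_words n" "y \<in> set (map spread xs)"
  shows "1 < \<bar>y\<bar>"
proof -
  obtain x where x: "x \<in> set xs" "y = spread x" using assms by auto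
  then have "\<bar>x\<bar> \<in> {1..int n}" using assms by (auto simp: BW_words_def)
  then have "x \<noteq> 0" "1 \<le> \<bar>x\<bar>" by auto
  then show ?thesis using x abs_spread by simp
qed

text \<open>Deleting the letter of absolute value 1 and lowering the other absolute values by one
  inverts the insertion; \<open>maxima_negative_insert\<close> transfers the sign condition both
  ways.\<close>

lemma BW_words_Suc:
  "BW_words (Suc n) = (\<Union>xs\<in>BW_words n. set (insert_one (map spread xs)))"
proof (intro set_eqI iffI)
  fix zs assume "zs \<in> (\<Union>xs\<in>BW_words n. set (insert_one (map spread xs)))"
  then obtain xs where xs: "xs \<in> BW_words n" and "zs \<in> set (insert_one (map spread xs))" by auto
  then obtain us e vs where *: "map spread xs = us @ vs" "zs = us @ e # vs" "\<bar>e\<bar> = 1" "vs = [] \<longrightarrow> e < 0"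
    by (auto simp: in_insert_one_iff)
  have gt: "\<forall>y\<in>set (us @ vs). 1 < \<bar>y\<bar>" using BW_words_spread_gt1[OF xs] *(1) by metis
  have "maxima_negative (us @ vs)"
    using xs maxima_negative_spread[of xs] *(1) by (simp add: BW_words_def)
  then have m: "maxima_negative zs" using maxima_negative_insert[OF gt *(3)] * by simp
  have "length zs = Suc (length (map spread xs))" unfolding *(1,2) by simp
  then have l: "length zs = Suc n" using xs by (simp add: BW_words_def)
  have "abs ` set zs = insert 1 (abs ` set (map spread xs))"
    unfolding *(1,2) using *(3) by auto
  also have "abs ` set (map spread xs) = (\<lambda>x. x + 1) ` abs ` set xs"
  proof -
    have "x \<noteq> 0" if "x \<in> set xs" for x
    proof -
      have "\<bar>x\<bar> \<in> {1..int n}" using xs that by (auto simp: BW_words_def)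
      then show ?thesis by auto
    qed
    then show ?thesis by (force simp: image_image abs_spread intro: image_cong)
  qed
  also have "abs ` set xs = {1..int n}" using xs by (simp add: BW_words_def)
  also have "insert 1 ((\<lambda>x. x + 1) ` {1..int n}) = {1..int (Suc n)}"
  proof -
    have "(\<lambda>x. x + 1) ` {1..int n} = {2..int n + 1}" by (simp add: image_add_int_atLeastLessThan)
    then show ?thesis by auto
  qed
  finally show "zs \<in> BW_words (Suc n)" using l m by (simp add: BW_words_def)
next
  fix zs assume "zs \<in> BW_words (Suc n)"
  then have l: "length zs = Suc n" and s: "abs ` set zs = {1..int (Suc n)}" and m: "maxima_negative zs"
    by (auto simp: BW_words_def)
  have "1 \<in> abs ` set zs" using s by auto
  then obtain e where "e \<in> set zs" and e: "\<bar>e\<bar> = 1" by auto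
  then obtain us vs where zs: "zs = us @ e # vs" using split_list by metis
  \<comment> \<open>Since \<open>Suc n\<close> letters cover \<open>Suc n\<close> absolute values,
    none repeats and \<open>e\<close> is the only letter of absolute value 1.\<close>
  have "card (set (map abs zs)) = length (map abs zs)" using s l by simp
  then have "distinct (map abs zs)" by (rule card_distinct)
  then have ne: "1 \<notin> abs ` set (us @ vs)" using e zs by auto
  have "insert 1 (abs ` set (us @ vs)) = {1..int (Suc n)}" using s zs e by auto
  then have s': "abs ` set (us @ vs) = {2..int (Suc n)}" using ne
  proof -
    assume "insert 1 (abs ` set (us @ vs)) = {1..int (Suc n)}"
    then have "abs ` set (us @ vs) = {1..int (Suc n)} - {1}" using ne by blast
    then show ?thesis by auto
  qed
  then have gt: "\<forall>y\<in>set (us @ vs). 1 < \<bar>y\<bar>"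
    by (metis atLeastAtMost_iff image_eqI zless_add1_eq one_add_one add1_zle_eq)
  then have "\<forall>y\<in>set (us @ vs). \<exists>x. x \<noteq> 0 \<and> y = spread x" using ex_spread by blast
  then obtain g where g: "\<forall>y\<in>set (us @ vs). g y \<noteq> 0 \<and> y = spread (g y)" by metis
  define xs where "xs = map g (us @ vs)"
  have xs: "map spread xs = us @ vs" using g by (auto simp: xs_def intro: map_idI)
  have "length xs = n" using l zs by (simp add: xs_def)
  moreover have "maxima_negative xs" "vs = [] \<longrightarrow> e < 0"
    using maxima_negative_insert[OF gt e] m zs xs maxima_negative_spread[of xs] by auto
  moreover have "abs ` set xs = {1..int n}"
  proof -
    have "(\<lambda>x. x + 1) ` abs ` set xs = abs ` set (us @ vs)"
    proof -
      have "\<bar>g y\<bar> + 1 = \<bar>y\<bar>" if "y \<in> set (us @ vs)" for y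
        using g that abs_spread[of "g y"] by metis
      then show ?thesis by (force simp: xs_def image_image)
    qed
    then have "(\<lambda>x. x - 1) ` (\<lambda>x. x + 1) ` abs ` set xs = (\<lambda>x. x - 1) ` {2..int (Suc n)}"
      using s' by metis
    then show ?thesis by (simp add: image_image)
  qed
  ultimately have "xs \<in> BW_words n" "zs \<in> set (insert_one (map spread xs))"
    unfolding in_insert_one_iff using xs zs e by (auto simp: BW_words_def)
  then show "zs \<in> (\<Union>xs\<in>BW_words n. set (insert_one (map spread xs)))" by auto
qed

lemma finite_BW_words: "finite (BW_words n)"
  by (induction n) (auto simp: BW_words_0 BW_words_Suc)

lemma sum_BW_words_Suc:
  fixes \<phi> :: "nat \<Rightarrow> int"
  shows "(\<Sum>zs\<in>BW_words (Suc n). \<phi> (des_from 0 zs)) =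
    (\<Sum>xs\<in>BW_words n. 2 * int (des_from 0 xs) * \<phi> (des_from 0 xs) +
      (2 * int n + 1 - 2 * int (des_from 0 xs)) * \<phi> (Suc (des_from 0 xs)))"
proof -
  have inj: "map spread xs = map spread ys \<Longrightarrow> xs = ys" for xs ys
    using inj_spread by (simp add: inj_map_eq_map)
  have "(\<Sum>zs\<in>BW_words (Suc n). \<phi> (des_from 0 zs)) =
      (\<Sum>xs\<in>BW_words n. \<Sum>zs\<in>set (insert_one (map spread xs)). \<phi> (des_from 0 zs))"
    unfolding BW_words_Suc
  proof (rule sum.UNION_disjoint)
    show "\<forall>xs\<in>BW_words n. \<forall>ys\<in>BW_words n. xs \<noteq> ys \<longrightarrow>
        set (insert_one (map spread xs)) \<inter> set (insert_one (map spread ys)) = {}"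
    proof (intro ballI impI)
      fix xs ys assume "xs \<in> BW_words n" "ys \<in> BW_words n" "xs \<noteq> ys"
      then have "\<forall>y\<in>set (map spread xs). 1 < \<bar>y\<bar>" "\<forall>y\<in>set (map spread ys). 1 < \<bar>y\<bar>"
        and "map spread xs \<noteq> map spread ys"
        using BW_words_spread_gt1 inj by blast+
      then show "set (insert_one (map spread xs)) \<inter> set (insert_one (map spread ys)) = {}"
        using filter_insert_one by (metis disjoint_iff)
    qed
  qed (auto simp: finite_BW_words)
  also have "\<dots> = (\<Sum>xs\<in>BW_words n. 2 * int (des_from 0 xs) * \<phi> (des_from 0 xs) +
      (2 * int n + 1 - 2 * int (des_from 0 xs)) * \<phi> (Suc (des_from 0 xs)))"
  proof (rule sum.cong[OF refl])
    fix xs assume xs: "xs \<in> BW_words n"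
    let ?ys = "map spread xs"
    have gt: "\<forall>y\<in>set ?ys. 1 < \<bar>y\<bar>" using BW_words_spread_gt1[OF xs] by blast
    have "maxima_negative ?ys" using xs by (simp add: BW_words_def maxima_negative_spread)
    then have last: "?ys \<noteq> [] \<longrightarrow> last ?ys < 0" using maxima_negative_last by blast
    have "des_from 0 ?ys = des_from 0 xs" using des_from_spread[of 0 xs] by simp
    then show "(\<Sum>zs\<in>set (insert_one ?ys). \<phi> (des_from 0 zs)) =
      2 * int (des_from 0 xs) * \<phi> (des_from 0 xs) +
      (2 * int n + 1 - 2 * int (des_from 0 xs)) * \<phi> (Suc (des_from 0 xs))"
      using sum_list_insert_one_des_0[OF gt last, of \<phi>] xs
        sum_list_distinct_conv_sum_set[OF distinct_insert_one[OF gt], of "\<lambda>zs. \<phi> (des_from 0 zs)"]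
      by (simp add: BW_words_def)
  qed
  finally show ?thesis .
qed

lemma des_from_le_length: "des_from p xs \<le> length xs"
  by (induction xs arbitrary: p) (auto intro: le_SucI)

section \<open>Window notation and comparison of the recursions\<close>

lemma des_from_eq_card: "des_from p xs = card {i. i < length xs \<and> xs ! i < (p # xs) ! i}"
proof (induction xs arbitrary: p)
  case (Cons x xs)
  let ?A = "{i. i < length xs \<and> xs ! i < (x # xs) ! i}"
  have "{i. i < length (x # xs) \<and> (x # xs) ! i < (p # x # xs) ! i} =
      (if x < p then {0} else {}) \<union> Suc ` ?A"
    by (auto simp: less_Suc_eq_0_disj)
  moreover have "card ((if x < p then {0} else {}) \<union> Suc ` ?A) = (if x < p then 1 else 0) + card (Suc ` ?A)"
    by (auto simp: card_insert_if)
  ultimately show ?case using Cons.IH[of x] by (simp add: card_image)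
qed simp

lemma maxima_negative_iff:
  "maxima_negative xs \<longleftrightarrow>
    (\<forall>i<length xs. (\<forall>j<length xs. i < j \<longrightarrow> \<bar>xs ! j\<bar> < \<bar>xs ! i\<bar>) \<longrightarrow> xs ! i < 0)"
proof (induction xs)
  case (Cons x xs)
  have "(\<forall>y\<in>set xs. \<bar>y\<bar> < \<bar>x\<bar>) \<longleftrightarrow> (\<forall>j<length xs. \<bar>xs ! j\<bar> < \<bar>x\<bar>)"
    by (simp add: all_set_conv_all_nth)
  then show ?case using Cons.IH by (simp add: All_less_Suc2)
qed simp

definition window :: "nat \<Rightarrow> (int \<Rightarrow> int) \<Rightarrow> int list" where
  "window n w = map (\<lambda>i. w (int i + 1)) [0..<n]"

lemma length_window [simp]: "length (window n w) = n"
  by (simp add: window_def)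

lemma nth_window [simp]: "i < n \<Longrightarrow> window n w ! i = w (int i + 1)"
  by (simp add: window_def)

lemma set_window: "set (window n w) = w ` {1..int n}"
proof -
  have "(\<lambda>i. int i + 1) ` {0..<n} = {1..int n}"
  proof (intro subset_antisym subsetI)
    fix k assume "k \<in> {1..int n}"
    then show "k \<in> (\<lambda>i. int i + 1) ` {0..<n}" by (intro image_eqI[of _ _ "nat (k - 1)"]) auto
  qed auto
  then show ?thesis unfolding window_def by (metis (no_types, lifting) image_image set_map set_upt image_cong)
qed

lemma desB_eq_des_from: "desB n w = des_from 0 (window n w)"
proof -
  \<comment> \<open>The shift by one is absorbed by the leading 0: entry \<open>i\<close> of the
    window is \<open>w (i + 1)\<close>, and entry \<open>i\<close> of the prefixed list is the
    letter before it.\<close>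
  have "{i\<in>{0..int n - 1}. (if i = 0 then 0 else w i) > w (i + 1)} =
      int ` {i. i < length (window n w) \<and> window n w ! i < (0 # window n w) ! i}" (is "?L = int ` ?R")
  proof (intro subset_antisym subsetI)
    fix i assume i: "i \<in> ?L"
    then have "nat i \<in> ?R" by (auto simp: nth_Cons' split: if_splits)
    then show "i \<in> int ` ?R" using i by (intro image_eqI[of _ _ "nat i"]) auto
  next
    fix i assume "i \<in> int ` ?R"
    then show "i \<in> ?L" by (auto simp: nth_Cons' split: if_splits)
  qed
  then show ?thesis unfolding desB_def des_from_eq_card by (simp add: card_image)
qed

lemma maxima_negative_window:
  "maxima_negative (window n w) \<longleftrightarrow>
    (\<forall>i\<in>{1..int n}. (\<forall>j\<in>{i+1..int n}. \<bar>w i\<bar> > \<bar>w j\<bar>) \<longrightarrow> w i < 0)" (is "?l \<longleftrightarrow> ?r")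
proof
  assume l: ?l
  show ?r
  proof (intro ballI impI)
    fix i assume i: "i \<in> {1..int n}" and *: "\<forall>j\<in>{i+1..int n}. \<bar>w i\<bar> > \<bar>w j\<bar>"
    have "window n w ! nat (i - 1) < 0"
      using l[unfolded maxima_negative_iff, rule_format, of "nat (i - 1)"] i * by auto
    then show "w i < 0" using i by auto
  qed
next
  assume r: ?r
  show ?l unfolding maxima_negative_iff
  proof (intro allI impI)
    fix i assume i: "i < length (window n w)"
      and *: "\<forall>j<length (window n w). i < j \<longrightarrow> \<bar>window n w ! j\<bar> < \<bar>window n w ! i\<bar>"
    have "\<bar>w (int i + 1)\<bar> > \<bar>w j\<bar>" if "j \<in> {int i + 1 + 1..int n}" for j
      using *[rule_format, of "nat (j - 1)"] that i by auto
    then have "w (int i + 1) < 0" using r i by auto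
    then show "window n w ! i < 0" using i by simp
  qed
qed

lemma window_in_BW_words:
  assumes "w \<in> BW_B n"
  shows "window n w \<in> BW_words n"
proof -
  let ?I = "{i. 1 \<le> \<bar>i\<bar> \<and> \<bar>i\<bar> \<le> int n}"
  have bij: "bij_betw w ?I ?I" and odd: "\<And>i. i \<in> ?I \<Longrightarrow> w (- i) = - w i"
    using assms by (auto simp: BW_B_def signed_perms_def)
  have "abs ` w ` {1..int n} = {1..int n}"
  proof (intro subset_antisym subsetI)
    fix k assume "k \<in> abs ` w ` {1..int n}"
    then obtain i where "k = \<bar>w i\<bar>" "i \<in> ?I" by auto
    moreover have "w i \<in> ?I" using bij_betw_apply[OF bij] \<open>i \<in> ?I\<close> .
    ultimately show "k \<in> {1..int n}" by simp
  next
    fix k assume k: "k \<in> {1..int n}"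
    then have "k \<in> w ` ?I" using bij by (auto simp: bij_betw_def)
    then obtain i where i: "i \<in> ?I" "k = w i" by blast
    \<comment> \<open>Oddness moves a negative preimage to a positive one, changing only the sign of
      the value.\<close>
    then have "\<bar>w \<bar>i\<bar>\<bar> = k" using odd[OF i(1)] k by (auto simp: abs_if)
    then show "k \<in> abs ` w ` {1..int n}" using i(1)
      by (intro image_eqI[of _ abs "w \<bar>i\<bar>"] image_eqI[of _ w "\<bar>i\<bar>"]) auto
  qed
  moreover have "maxima_negative (window n w)"
    using assms by (simp add: maxima_negative_window BW_B_def)
  ultimately show ?thesis by (simp add: BW_words_def set_window)
qed

text \<open>Oddness determines the values at negative arguments, and outside [+-n] both maps are the
  identity.\<close>

lemma inj_on_window: "inj_on (window n) (BW_B n)"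
proof (rule inj_onI)
  fix w v assume w: "w \<in> BW_B n" and v: "v \<in> BW_B n" and eq: "window n w = window n v"
  have pos: "w i = v i" if "1 \<le> i" "i \<le> int n" for i
  proof -
    have "window n w ! nat (i - 1) = window n v ! nat (i - 1)" using eq by simp
    then show ?thesis using that by auto
  qed
  show "w = v"
  proof
    fix i
    consider "1 \<le> i" "i \<le> int n" | "1 \<le> - i" "- i \<le> int n" | "\<not> (1 \<le> \<bar>i\<bar> \<and> \<bar>i\<bar> \<le> int n)"
      by linarith
    then show "w i = v i"
    proof cases
      case 2
      then have "w (- (- i)) = - w (- i)" "v (- (- i)) = - v (- i)"
        using w v unfolding BW_B_def signed_perms_def by auto
      then show ?thesis using pos[OF 2] by simp
    qed (use pos w v in \<open>auto simp: BW_B_def signed_perms_def\<close>)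
  qed
qed

lemma BW_words_subset_window:
  assumes xs: "xs \<in> BW_words n"
  shows "xs \<in> window n ` BW_B n"
proof -
  let ?I = "{i. 1 \<le> \<bar>i\<bar> \<and> \<bar>i\<bar> \<le> int n}"
  have len: "length xs = n" and abs: "abs ` set xs = {1..int n}" and mx: "maxima_negative xs"
    using xs by (auto simp: BW_words_def)
  \<comment> \<open>The odd extension of the word; list positions start at 0, hence the subtraction
    of 1.\<close>
  define w where "w i = (if i \<in> ?I then sgn i * xs ! (nat \<bar>i\<bar> - 1) else i)" for i
  have nth: "\<bar>xs ! k\<bar> \<in> {1..int n}" if "k < n" for k
    using that len abs nth_mem[of k xs] by blast
  have "card (set (map abs xs)) = length (map abs xs)" using abs len by simp
  then have dist: "distinct (map abs xs)" by (rule card_distinct)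
  have abs_w: "\<bar>w i\<bar> = \<bar>xs ! (nat \<bar>i\<bar> - 1)\<bar>" if "i \<in> ?I" for i
    using that by (auto simp: w_def abs_mult)
  have k: "nat \<bar>i\<bar> - 1 < n" if "i \<in> ?I" for i using that by auto
  have maps: "w i \<in> ?I" if "i \<in> ?I" for i
    using abs_w[OF that] nth[OF k[OF that]] by auto
  have "inj_on w ?I"
  proof (rule inj_onI)
    fix i j assume i: "i \<in> ?I" and j: "j \<in> ?I" and eq: "w i = w j"
    then have "map abs xs ! (nat \<bar>i\<bar> - 1) = map abs xs ! (nat \<bar>j\<bar> - 1)"
      using abs_w[OF i] abs_w[OF j] k[OF i] k[OF j] len by simp
    then have "nat \<bar>i\<bar> - 1 = nat \<bar>j\<bar> - 1"
      using nth_eq_iff_index_eq[OF dist] k[OF i] k[OF j] len by simp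
    moreover have "1 \<le> nat \<bar>i\<bar>" "1 \<le> nat \<bar>j\<bar>" using i j by auto
    ultimately have "nat \<bar>i\<bar> = nat \<bar>j\<bar>" using eq_diff_iff by blast
    then have "\<bar>i\<bar> = \<bar>j\<bar>" by (simp add: eq_nat_nat_iff)
    \<comment> \<open>With equal, nonzero letters the sign of the argument can be read off from the
      value.\<close>
    moreover have "xs ! (nat \<bar>i\<bar> - 1) \<noteq> 0" using nth[OF k[OF i]] by auto
    ultimately have "sgn i = sgn j" using eq i j by (simp add: w_def)
    then show "i = j" using \<open>\<bar>i\<bar> = \<bar>j\<bar>\<close> by (metis sgn_mult_abs)
  qed
  moreover have "finite ?I" by (rule finite_subset[of _ "{- int n..int n}"]) auto
  ultimately have "bij_betw w ?I ?I"
    using maps endo_inj_surj[of ?I w] by (auto simp: bij_betw_def)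
  then have sp: "w \<in> signed_perms n"
    by (auto simp: signed_perms_def w_def)
  have win: "window n w = xs"
    by (rule nth_equalityI) (auto simp: len w_def nat_add_distrib)
  have "w \<in> BW_B n" using sp mx maxima_negative_window[of n w] win by (simp add: BW_B_def)
  then show ?thesis using win by blast
qed

lemma sum_BW_B:
  "(\<Sum>w\<in>BW_B n. \<phi> (desB n w)) = (\<Sum>xs\<in>BW_words n. \<phi> (des_from 0 xs))"
proof -
  have "BW_words n = window n ` BW_B n"
    using window_in_BW_words BW_words_subset_window by blast
  then show ?thesis by (simp add: sum.reindex[OF inj_on_window] desB_eq_des_from)
qed

text \<open>Split \<open>d\<close> as j + (d - j) and absorb d - j into the next binomial. This
  removes the factor \<open>d\<close> from the descent recursion.\<close>

lemma times_binomial_self: "int d * int (d choose j) = int j * int (d choose j) + int (Suc j) * int (d choose Suc j)"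
proof (cases "j \<le> d")
  case True
  have "Suc j * (d choose Suc j) = (d - j) * (d choose j)"
    using binomial_absorb_comp[of d j] binomial_absorption[of j d]
    by (metis binomial_absorb_comp binomial_absorption mult.commute)
  then have "int (Suc j) * int (d choose Suc j) = int (d - j) * int (d choose j)"
    by (metis of_nat_mult)
  then show ?thesis using True by (simp add: of_nat_diff algebra_simps)
qed (simp add: binomial_eq_0)

text \<open>Both sides are coefficients of the j-th power of z - 1 and satisfy the same recursion in
  \<open>n\<close>. Writing \<open>nfix c + j = n\<close> avoids truncated subtraction.\<close>

lemma sum_binomial_des_eq_sum_codes:
  "(\<Sum>xs\<in>BW_words n. int (des_from 0 xs choose j)) =
   (\<Sum>c\<in>codes n. if nfix c + j = n then odd_fact (nfix c) else 0)"
proof (induction n arbitrary: j)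
  case 0
  have "nfix (\<lambda>_. 0) = 0" by (auto simp: nfix_def code_fixpoints_def)
  then show ?case by (cases j) (simp_all add: BW_words_0 codes_0 odd_fact_def)
next
  case (Suc n)
  have odd_fact_Suc: "odd_fact (Suc k) = (2 * int k + 1) * odd_fact k" for k
    by (simp add: odd_fact_def)
  define g where "g j d = 2 * int d * int (d choose j) +
      (2 * int n + 1 - 2 * int d) * int (Suc d choose j)" for j d
  define h where "h j k = int (2 * k + 1) * (if k + j = Suc n then odd_fact k else 0) +
      (if Suc k + j = Suc n then odd_fact (Suc k) else 0)" for j k
  have lhs: "(\<Sum>xs\<in>BW_words (Suc n). int (des_from 0 xs choose j)) = (\<Sum>xs\<in>BW_words n. g j (des_from 0 xs))"
    unfolding g_def by (rule sum_BW_words_Suc)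
  have rhs: "(\<Sum>c\<in>codes (Suc n). if nfix c + j = Suc n then odd_fact (nfix c) else 0) =
      (\<Sum>c\<in>codes n. h j (nfix c))"
    unfolding h_def
    using sum_codes_Suc[of "\<lambda>k. if k + j = Suc n then odd_fact k else 0" n] by simp
  show ?case
  proof (cases j)
    case 0
    have "g 0 d = (2 * int n + 1) * int (d choose 0)" for d by (simp add: g_def)
    \<comment> \<open>The first indicator in \<open>h\<close> would need \<open>k = Suc n\<close>,
      which the bound \<open>k \<le> n\<close> excludes.\<close>
    moreover have "h 0 k = (2 * int n + 1) * (if k + 0 = n then odd_fact k else 0)" if "k \<le> n" for k
      using that by (simp add: h_def odd_fact_Suc)
    ultimately show ?thesis unfolding lhs rhs unfolding 0
      using Suc.IH[of 0] by (simp add: nfix_le sum_distrib_left[symmetric] del: binomial_n_0)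
  next
    case (Suc i)
    \<comment> \<open>Pascal's rule splits \<open>Suc d choose Suc i\<close>; then
      \<open>times_binomial_self\<close> makes the coefficients independent of
      \<open>d\<close>.\<close>
    have g: "g (Suc i) d = (2 * int n - 1 - 2 * int i) * int (d choose Suc i) +
        (2 * int n + 1 - 2 * int i) * int (d choose i)" for d
    proof -
      have "g (Suc i) d = (2 * int n + 1) * int (d choose Suc i) + (2 * int n + 1) * int (d choose i)
          - 2 * (int d * int (d choose i))"
        by (simp add: g_def algebra_simps)
      then show ?thesis unfolding times_binomial_self by (simp add: algebra_simps)
    qed
    \<comment> \<open>Each indicator fixes \<open>k\<close>, as n - i or n - i - 1, so the factor 2k
      + 1 becomes a constant.\<close>
    have h: "h (Suc i) k = (2 * int n - 1 - 2 * int i) * (if k + Suc i = n then odd_fact k else 0) +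
        (2 * int n + 1 - 2 * int i) * (if k + i = n then odd_fact k else 0)" for k
      by (auto simp: h_def odd_fact_Suc)
    show ?thesis unfolding lhs rhs unfolding Suc g h sum.distrib sum_distrib_left[symmetric] Suc.IH ..
  qed
qed

theorem theorem6p3:
  fixes z :: "'a::comm_ring_1"
  shows "poincare_B TYPE('n::finite) z
           = (\<Sum>w\<in>BW_B CARD('n). z ^ desB CARD('n) w)"
proof -
  let ?n = "CARD('n)"
  let ?t = "z - 1"
  \<comment> \<open>Binomial expansion of (z - 1) + 1; the uniform upper limit lets the sums be
    interchanged later.\<close>
  have power: "z ^ d = (\<Sum>j\<le>?n. of_int (int (d choose j)) * ?t ^ j)" if "d \<le> ?n" for d
  proof -
    have "z ^ d = (?t + 1) ^ d" by simp
    also have "\<dots> = (\<Sum>j\<le>d. of_nat (d choose j) * ?t ^ j)" 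
      by (subst binomial_ring) simp
    also have "\<dots> = (\<Sum>j\<le>?n. of_nat (d choose j) * ?t ^ j)"
      using that by (intro sum.mono_neutral_left) (auto simp: binomial_eq_0)
    finally show ?thesis by simp
  qed
  \<comment> \<open>The single power is spread over all exponents by an indicator, to match the
    coefficient form of the other side.\<close>
  have odd_fact_term: "of_int (odd_fact k) * ?t ^ (?n - k) =
      (\<Sum>j\<le>?n. of_int (if k + j = ?n then odd_fact k else 0) * ?t ^ j)" if "k \<le> ?n" for k
  proof -
    have "(\<Sum>j\<le>?n. of_int (if k + j = ?n then odd_fact k else 0) * ?t ^ j) =
        (\<Sum>j\<le>?n. if j = ?n - k then of_int (odd_fact k) * ?t ^ j else 0)"
      using that by (intro sum.cong) auto
    then show ?thesis by (simp add: sum.delta)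
  qed
  have "(\<Sum>w\<in>BW_B ?n. z ^ desB ?n w) = (\<Sum>xs\<in>BW_words ?n. z ^ des_from 0 xs)"
    by (rule sum_BW_B)
  also have "\<dots> = (\<Sum>xs\<in>BW_words ?n. \<Sum>j\<le>?n. of_int (int (des_from 0 xs choose j)) * ?t ^ j)"
  proof (rule sum.cong[OF refl])
    fix xs assume "xs \<in> BW_words ?n"
    then have "des_from 0 xs \<le> ?n" using des_from_le_length[of 0 xs] by (simp add: BW_words_def)
    then show "z ^ des_from 0 xs = (\<Sum>j\<le>?n. of_int (int (des_from 0 xs choose j)) * ?t ^ j)"
      by (rule power)
  qed
  \<comment> \<open>Interchanging the sums collects the coefficient of each power of z - 1, where
    the two sides are compared.\<close>
  also have "\<dots> = (\<Sum>j\<le>?n. of_int (\<Sum>xs\<in>BW_words ?n. int (des_from 0 xs choose j)) * ?t ^ j)"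
    by (subst sum.swap) (simp add: sum_distrib_right)
  also have "\<dots> = (\<Sum>j\<le>?n. of_int (\<Sum>c\<in>codes ?n. if nfix c + j = ?n then odd_fact (nfix c) else 0) * ?t ^ j)"
    unfolding sum_binomial_des_eq_sum_codes ..
  also have "\<dots> = (\<Sum>c\<in>codes ?n. \<Sum>j\<le>?n. of_int (if nfix c + j = ?n then odd_fact (nfix c) else 0) * ?t ^ j)"
    unfolding of_int_sum sum_distrib_right by (rule sum.swap)
  also have "\<dots> = (\<Sum>c\<in>codes ?n. of_int (odd_fact (nfix c)) * ?t ^ (?n - nfix c))"
    by (intro sum.cong refl odd_fact_term[symmetric] nfix_le)
  also have "\<dots> = poincare_B TYPE('n) z" by (rule poincare_B_codes[symmetric])
  finally show ?thesis by (rule sym)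
qed

end
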